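(* Let $1\le k\le n-1$ and $l\ge1$. Let $\psi:B^{k,l}\to B^{k,l}$ be the bijection such that $\psi\circ\widetilde f_i=\widetilde f_{i+1}\circ\psi$ for all $i\in I=\{0,1,\dots,n-1\}$ (subscripts modulo $n$). Then $\psi$ is given by the promotion operator: $\psi(b)=\mathrm{pr}(b)$ for all $b\in B^{k,l}=\mathrm{CST}((l^k))$.
   Context: Fix $n\ge 2$, $[n]=\{1,\dots,n\}$. $B^{k,l}$ is the classical $\widehat{sl}_n$ crystal (Kirillov–Reshetikhin crystal) of Kang–Kashiwara–Misra–Miwa–Nakashima–Nakayashiki: a connected crystal with edges colored by $I=\{0,1,\dots,n-1\}$ and weights in $P_{cl}=\bigoplus_{i\in I}\mathbb Z\Lambda_i$, the crystal graph of a finite-dimensional $U_q'(\widehat{sl}_n)$-module, unique with the property that its restriction to the colors $1,\dots,n-1$ is the $sl_n$ crystal of highest weight $l\Lambda_k$. It is realized on $\mathrm{CST}((l^k))$, the set of column-strict tableaux (entries in $[n]$, weakly increasing along rows, strictly increasing down columns) of shape the rectangle $(l^k)$ with $k$ rows and $l$ columns. For $1\le i\le n-1$ the operators act through the row-reading word (rows read left to right, bottom row first): write $+$ for each letter $i+1$ and $-$ for each letter $i$, cancel repeatedly adjacent pairs $+-$, leaving $-^s+^t$; $\widetilde f_i$ changes the letter $i$ at the rightmost remaining $-$ into $i+1$ and $\widetilde e_i$ changes the letter $i+1$ at the leftmost remaining $+$ into $i$ (undefined if $s=0$, resp. $t=0$). The equation $\psi\circ\widetilde f_i=\widetilde f_{i+1}\circ\psi$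 means that one side is defined iff the other is and they are then equal; such $\psi$ exists because the Dynkin diagram of $\widehat{sl}_n$ admits the rotation $i\mapsto i+1$. Promotion operator: for a column-strict tableau $b$, remove all the letters $n$ (they occupy a horizontal strip $H$); slide the remaining subtableau $b|_{[n-1]}$ by Schützenberger's jeu de taquin to the southeast into $H$, entering the cells of $H$ from left to right; fill the vacated cells with zeros; add one to each entry. The result is $\mathrm{pr}(b)$, of the same shape as $b$. *)

theory Defs
  imports "HOL-Computational_Algebra.Computational_Algebra"
begin

section \<open>Column-strict tableaux of rectangular shape\<close>

text \<open>A (possibly skew) filling is a partial map on cells (row, column), in English notation with
  1-based indices: row 1 is the top row, column 1 the leftmost column.\<close>

type_synonym cell = "nat \<times> nat"
type_synonym filling = "cell \<Rightarrow> nat option"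

definition rect :: "nat \<Rightarrow> nat \<Rightarrow> cell set" where
  "rect k l = {1..k} \<times> {1..l}"

definition CST :: "nat \<Rightarrow> nat \<Rightarrow> nat \<Rightarrow> filling set" where
  "CST n k l = {T. dom T = rect k l \<and> ran T \<subseteq> {1..n} \<and>
     (\<forall>r c. (r, c) \<in> rect k l \<and> (r, Suc c) \<in> rect k l \<longrightarrow> the (T (r, c)) \<le> the (T (r, Suc c))) \<and>
     (\<forall>r c. (r, c) \<in> rect k l \<and> (Suc r, c) \<in> rect k l \<longrightarrow> the (T (r, c)) < the (T (Suc r, c)))}"

definition mult :: "nat \<Rightarrow> filling \<Rightarrow> nat" where
  "mult a T = card {p. T p = Some a}"

definition reading :: "nat \<Rightarrow> nat \<Rightarrow> cell list" where
  "reading k l = [(r, c). r \<leftarrow> rev [1..<Suc k], c \<leftarrow> [1..<Suc l]]"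

text \<open>The \<open>i\<close>-signature lists the cells holding \<open>i\<close> or \<open>i + 1\<close> in reading order; the flag is
  \<open>True\<close> for the sign \<open>+\<close> (letter \<open>i + 1\<close>) and \<open>False\<close> for the sign \<open>-\<close> (letter \<open>i\<close>).\<close>

definition signature :: "nat \<Rightarrow> nat \<Rightarrow> nat \<Rightarrow> filling \<Rightarrow> (cell \<times> bool) list" where
  "signature k l i T =
     [(p, T p = Some (Suc i)). p \<leftarrow> reading k l, T p = Some i \<or> T p = Some (Suc i)]"

text \<open>The word left after all cancellations of adjacent pairs \<open>+-\<close>. A fully cancelled word has the
  form \<open>-\<dots>-+\<dots>+\<close>, so a letter put in front of it can only cancel if it is \<open>+\<close> and the word begins
  with \<open>-\<close>.\<close>

fun cancel :: "('a \<times> bool) list \<Rightarrow> ('a \<times> bool) list" where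
  "cancel [] = []"
| "cancel (x # xs) =
     (case cancel xs of
        [] \<Rightarrow> [x]
      | y # ys \<Rightarrow> if snd x \<and> \<not> snd y then ys else x # y # ys)"

definition cst_f :: "nat \<Rightarrow> nat \<Rightarrow> nat \<Rightarrow> filling \<Rightarrow> filling option" where
  "cst_f k l i T =
     (let ms = filter (\<lambda>x. \<not> snd x) (cancel (signature k l i T))
      in if ms = [] then None else Some (T(fst (last ms) \<mapsto> Suc i)))"

definition cst_e :: "nat \<Rightarrow> nat \<Rightarrow> nat \<Rightarrow> filling \<Rightarrow> filling option" where
  "cst_e k l i T =
     (let ps = filter snd (cancel (signature k l i T))
      in if ps = [] then None else Some (T(fst (hd ps) \<mapsto> i)))"


section \<open>Promotion\<close>

definition above :: "filling \<Rightarrow> nat \<Rightarrow> nat \<Rightarrow> nat option" where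
  "above T r c = (if r = 0 then None else T (r - 1, c))"

definition leftof :: "filling \<Rightarrow> nat \<Rightarrow> nat \<Rightarrow> nat option" where
  "leftof T r c = (if c = 0 then None else T (r, c - 1))"

text \<open>A jeu de taquin slide to the southeast into the empty cell \<open>(r, c)\<close>: the larger of the upper
  and left neighbours of the hole moves into it (the upper one if they are equal, to keep columns
  strict), until the hole has neither neighbour.\<close>

function slide :: "filling \<Rightarrow> nat \<Rightarrow> nat \<Rightarrow> filling" where
  "slide T r c =
     (if above T r c \<noteq> None \<and> (leftof T r c = None \<or> the (leftof T r c) \<le> the (above T r c))
      then slide (T((r, c) := above T r c, (r - 1, c) := None)) (r - 1) c
      else if leftof T r c \<noteq> None
      then slide (T((r, c) := leftof T r c, (r, c - 1) := None)) r (c - 1)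
      else T)"
  by auto
termination
  by (relation "measure (\<lambda>(T, r, c). r + c)") (auto simp: above_def leftof_def split: if_splits)

declare slide.simps [simp del]

text \<open>The cells holding \<open>n\<close>, from left to right (they form a horizontal strip, so each column
  contributes at most one).\<close>

definition strip :: "nat \<Rightarrow> nat \<Rightarrow> nat \<Rightarrow> filling \<Rightarrow> cell list" where
  "strip n k l T = [(r, c). c \<leftarrow> [1..<Suc l], r \<leftarrow> [1..<Suc k], T (r, c) = Some n]"

definition remove_letter :: "nat \<Rightarrow> filling \<Rightarrow> filling" where
  "remove_letter n T = (\<lambda>p. if T p = Some n then None else T p)"

definition pr :: "nat \<Rightarrow> nat \<Rightarrow> nat \<Rightarrow> filling \<Rightarrow> filling" where
  "pr n k l T =
     (let U = fold (\<lambda>(r, c) W. slide W r c) (strip n k l T) (remove_letter n T)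
      in (\<lambda>p. if p \<in> rect k l
               then Some (Suc (case U p of None \<Rightarrow> 0 | Some a \<Rightarrow> a))
               else None))"


section \<open>Crystals with weights in the classical weight lattice\<close>

text \<open>A weight is given by its coefficients in the fundamental weights, so that
  \<open>\<langle>h\<^sub>i, \<lambda>\<rangle> = \<lambda> i\<close>.\<close>

type_synonym weight = "nat \<Rightarrow> int"

definition Pcl :: "nat \<Rightarrow> weight set" where
  "Pcl n = {lam. \<forall>i\<ge>n. lam i = 0}"

text \<open>The entry \<open>\<langle>h\<^sub>i, \<alpha>\<^sub>j\<rangle>\<close> of the Cartan matrix, for \<open>n \<ge> 2\<close>. If \<open>n = 2\<close> both correction terms
  apply when \<open>i \<noteq> j\<close> and give the entry \<open>-2\<close>.\<close>

definition cartan :: "nat \<Rightarrow> nat \<Rightarrow> nat \<Rightarrow> int" where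
  "cartan n i j =
     2 * of_bool (i = j) - of_bool (j = Suc i mod n) - of_bool (i = Suc j mod n)"

definition simple_root :: "nat \<Rightarrow> nat \<Rightarrow> weight" where
  "simple_root n j = (\<lambda>i. if i < n then cartan n i j else 0)"

record 'b crystal_data =
  verts :: "'b set"
  cr_e :: "nat \<Rightarrow> 'b \<Rightarrow> 'b option"
  cr_f :: "nat \<Rightarrow> 'b \<Rightarrow> 'b option"
  cr_wt :: "'b \<Rightarrow> weight"

primrec iterate_op :: "('b \<Rightarrow> 'b option) \<Rightarrow> nat \<Rightarrow> 'b \<Rightarrow> 'b option" where
  "iterate_op g 0 b = Some b"
| "iterate_op g (Suc m) b = Option.bind (iterate_op g m b) g"

definition string_length :: "('b \<Rightarrow> 'b option) \<Rightarrow> 'b \<Rightarrow> nat" where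
  "string_length g b = Max {m. iterate_op g m b \<noteq> None}"

abbreviation cr_eps :: "'b crystal_data \<Rightarrow> nat \<Rightarrow> 'b \<Rightarrow> nat" where
  "cr_eps C i b \<equiv> string_length (cr_e C i) b"

abbreviation cr_phi :: "'b crystal_data \<Rightarrow> nat \<Rightarrow> 'b \<Rightarrow> nat" where
  "cr_phi C i b \<equiv> string_length (cr_f C i) b"

definition affine_crystal :: "nat \<Rightarrow> 'b crystal_data \<Rightarrow> bool" where
  "affine_crystal n C \<longleftrightarrow>
     (\<forall>b\<in>verts C. cr_wt C b \<in> Pcl n) \<and>
     (\<forall>i<n. \<forall>b\<in>verts C.
        set_option (cr_e C i b) \<subseteq> verts C \<and> set_option (cr_f C i b) \<subseteq> verts C \<and>
        (\<forall>b'\<in>verts C. cr_f C i b = Some b' \<longleftrightarrow> cr_e C i b' = Some b) \<and>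
        finite {m. iterate_op (cr_e C i) m b \<noteq> None} \<and>
        finite {m. iterate_op (cr_f C i) m b \<noteq> None} \<and>
        (\<forall>b'. cr_f C i b = Some b' \<longrightarrow> cr_wt C b' = (\<lambda>j. cr_wt C b j - simple_root n i j)) \<and>
        cr_wt C b i = int (cr_phi C i b) - int (cr_eps C i b))"

definition crystal_connected :: "nat \<Rightarrow> 'b crystal_data \<Rightarrow> bool" where
  "crystal_connected n C \<longleftrightarrow>
     (let E = {(b, b'). b \<in> verts C \<and> (\<exists>i<n. cr_f C i b = Some b')}
      in \<forall>b\<in>verts C. \<forall>b'\<in>verts C. (b, b') \<in> (E \<union> E\<inverse>)\<^sup>*)"


section \<open>Finite-dimensional modules over the quantum affine algebra\<close>

type_synonym qfield = "rat poly fract"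

definition qconst :: "rat \<Rightarrow> qfield" where
  "qconst a = to_fract [:a:]"

definition q :: qfield where
  "q = to_fract [:0, 1:]"

text \<open>The local ring of rational functions that are regular at \<open>q = 0\<close>.\<close>

definition regular_at_0 :: "qfield set" where
  "regular_at_0 = {to_fract a / to_fract b | a b. poly b 0 \<noteq> 0}"

definition qint :: "nat \<Rightarrow> qfield" where
  "qint m = (q ^ m - inverse q ^ m) / (q - inverse q)"

definition qfact :: "nat \<Rightarrow> qfield" where
  "qfact m = (\<Prod>j=1..m. qint j)"

text \<open>The fields \<open>act_E\<close>, \<open>act_F\<close>, \<open>act_K\<close> are the actions of the Chevalley generators \<open>e\<^sub>i\<close>, \<open>f\<^sub>i\<close>
  and of \<open>q\<close> to the power \<open>h\<^sub>i\<close>, for \<open>i = 0, \<dots>, n - 1\<close>.\<close>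

record 'v qmodule =
  scal :: "qfield \<Rightarrow> 'v \<Rightarrow> 'v"
  act_E :: "nat \<Rightarrow> 'v \<Rightarrow> 'v"
  act_F :: "nat \<Rightarrow> 'v \<Rightarrow> 'v"
  act_K :: "nat \<Rightarrow> 'v \<Rightarrow> 'v"

definition divpow :: "'v::ab_group_add qmodule \<Rightarrow> ('v \<Rightarrow> 'v) \<Rightarrow> nat \<Rightarrow> 'v \<Rightarrow> 'v" where
  "divpow V X m v = scal V (inverse (qfact m)) ((X ^^ m) v)"

definition serre :: "nat \<Rightarrow> 'v::ab_group_add qmodule \<Rightarrow> (nat \<Rightarrow> 'v \<Rightarrow> 'v) \<Rightarrow> bool" where
  "serre n V X \<longleftrightarrow>
     (\<forall>i<n. \<forall>j<n. i \<noteq> j \<longrightarrow> (\<forall>v.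
        let b = nat (1 - cartan n i j)
        in (\<Sum>s\<le>b. scal V ((- 1) ^ s)
               (divpow V (X i) s (X j (divpow V (X i) (b - s) v)))) = 0))"

definition weight_space :: "nat \<Rightarrow> 'v::ab_group_add qmodule \<Rightarrow> weight \<Rightarrow> 'v set" where
  "weight_space n V lam = {v. \<forall>i<n. act_K V i v = scal V (q powi lam i) v}"

text \<open>A finite-dimensional module over \<open>U\<^sub>q'\<close> of affine \<open>sl\<^sub>n\<close> that is the sum of its weight spaces
  with weights in the classical weight lattice.\<close>

definition fd_Uq_module :: "nat \<Rightarrow> 'v::ab_group_add qmodule \<Rightarrow> bool" where
  "fd_Uq_module n V \<longleftrightarrow>
     vector_space (scal V) \<and>
     (\<exists>S. finite S \<and> module.span (scal V) S = UNIV) \<and>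
     (\<forall>i<n. Vector_Spaces.linear (scal V) (scal V) (act_E V i) \<and>
            Vector_Spaces.linear (scal V) (scal V) (act_F V i) \<and>
            Vector_Spaces.linear (scal V) (scal V) (act_K V i) \<and> bij (act_K V i)) \<and>
     (\<forall>i<n. \<forall>j<n. \<forall>v.
        act_K V i (act_K V j v) = act_K V j (act_K V i v) \<and>
        act_K V i (act_E V j v) = scal V (q powi cartan n i j) (act_E V j (act_K V i v)) \<and>
        act_K V i (act_F V j v) = scal V (q powi (- cartan n i j)) (act_F V j (act_K V i v)) \<and>
        act_E V i (act_F V j v) - act_F V j (act_E V i v) =
          (if i = j then scal V (inverse (q - inverse q)) (act_K V i v - inv (act_K V i) v)
           else 0)) \<and>
     serre n V (act_E V) \<and> serre n V (act_F V) \<and>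
     module.span (scal V) (\<Union>lam\<in>Pcl n. weight_space n V lam) = UNIV"


section \<open>Crystal graphs of modules\<close>

text \<open>The Kashiwara operators. On a module as above the vectors \<open>f\<^sub>i\<^sup>(\<^sup>m\<^sup>)u\<close>, with \<open>u\<close> a weight vector
  killed by \<open>e\<^sub>i\<close> and \<open>m\<close> at most \<open>\<langle>h\<^sub>i, wt u\<rangle>\<close>, span the module, and the conditions below
  determine the operators uniquely.\<close>

definition kashiwara_f :: "nat \<Rightarrow> 'v::ab_group_add qmodule \<Rightarrow> nat \<Rightarrow> 'v \<Rightarrow> 'v" where
  "kashiwara_f n V i = (THE g. Vector_Spaces.linear (scal V) (scal V) g \<and>
     (\<forall>lam\<in>Pcl n. \<forall>u\<in>weight_space n V lam. act_E V i u = 0 \<longrightarrow>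
        (\<forall>m. int m \<le> lam i \<longrightarrow>
           g (divpow V (act_F V i) m u) = divpow V (act_F V i) (Suc m) u)))"

definition kashiwara_e :: "nat \<Rightarrow> 'v::ab_group_add qmodule \<Rightarrow> nat \<Rightarrow> 'v \<Rightarrow> 'v" where
  "kashiwara_e n V i = (THE g. Vector_Spaces.linear (scal V) (scal V) g \<and>
     (\<forall>lam\<in>Pcl n. \<forall>u\<in>weight_space n V lam. act_E V i u = 0 \<longrightarrow>
        (\<forall>m. int m \<le> lam i \<longrightarrow>
           g (divpow V (act_F V i) m u) =
             (case m of 0 \<Rightarrow> 0 | Suc m' \<Rightarrow> divpow V (act_F V i) m' u))))"

text \<open>In the first condition \<open>S\<close> is a basis of the module that is also a basis of the lattice over
  the local ring; the second says that the lattice is the sum of its weight components.\<close>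

definition crystal_lattice :: "nat \<Rightarrow> 'v::ab_group_add qmodule \<Rightarrow> 'v set \<Rightarrow> bool" where
  "crystal_lattice n V L \<longleftrightarrow>
     (\<exists>S. finite S \<and> \<not> module.dependent (scal V) S \<and> module.span (scal V) S = UNIV \<and>
        L = {\<Sum>s\<in>S. scal V (a s) s | a. \<forall>s\<in>S. a s \<in> regular_at_0}) \<and>
     (\<forall>v\<in>L. \<exists>W w. finite W \<and> W \<subseteq> Pcl n \<and>
        (\<forall>lam\<in>W. w lam \<in> L \<inter> weight_space n V lam) \<and> v = (\<Sum>lam\<in>W. w lam)) \<and>
     (\<forall>i<n. kashiwara_e n V i ` L \<subseteq> L \<and> kashiwara_f n V i ` L \<subseteq> L)"

text \<open>Equality of residue classes in \<open>L / qL\<close>.\<close>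

definition qcong :: "'v::ab_group_add qmodule \<Rightarrow> 'v set \<Rightarrow> 'v \<Rightarrow> 'v \<Rightarrow> bool" where
  "qcong V L u v \<longleftrightarrow> (\<exists>w\<in>L. u - v = scal V q w)"

text \<open>A crystal pseudobase \<open>(L, B)\<close>, with \<open>B = B' \<union> -B'\<close> and \<open>B'\<close> a rational basis of \<open>L / qL\<close>. The set
  \<open>B'\<close> is given by an indexed family: \<open>bas x\<close> (for \<open>x \<in> X\<close>) is a representative in \<open>L\<close>, of weight
  \<open>wt x\<close>, of the element of \<open>B'\<close> labelled \<open>x\<close>. Thus \<open>X\<close> labels \<open>B\<close> modulo sign, the vertex set of
  the crystal graph. A crystal base is the case in which only the sign \<open>s = 1\<close> occurs.\<close>

definition crystal_pseudobase ::
    "nat \<Rightarrow> 'v::ab_group_add qmodule \<Rightarrow> 'v set \<Rightarrow> 'b set \<Rightarrow> ('b \<Rightarrow> weight) \<Rightarrow> ('b \<Rightarrow> 'v) \<Rightarrow> bool" where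
  "crystal_pseudobase n V L X wt bas \<longleftrightarrow>
     crystal_lattice n V L \<and>
     finite X \<and>
     (\<forall>x\<in>X. wt x \<in> Pcl n \<and> bas x \<in> L \<inter> weight_space n V (wt x)) \<and>
     (\<forall>u\<in>L. \<exists>a. qcong V L u (\<Sum>x\<in>X. scal V (qconst (a x)) (bas x))) \<and>
     (\<forall>a. qcong V L (\<Sum>x\<in>X. scal V (qconst (a x)) (bas x)) 0 \<longrightarrow> (\<forall>x\<in>X. a x = 0)) \<and>
     (\<forall>i<n. \<forall>x\<in>X.
        (qcong V L (kashiwara_e n V i (bas x)) 0 \<or>
           (\<exists>y\<in>X. \<exists>s\<in>{1, - 1}. qcong V L (kashiwara_e n V i (bas x)) (scal V s (bas y)))) \<and>
        (qcong V L (kashiwara_f n V i (bas x)) 0 \<or>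
           (\<exists>y\<in>X. \<exists>s\<in>{1, - 1}. qcong V L (kashiwara_f n V i (bas x)) (scal V s (bas y)))) \<and>
        (\<forall>y\<in>X. \<forall>s\<in>{1, - 1}.
           qcong V L (kashiwara_f n V i (bas x)) (scal V s (bas y)) \<longleftrightarrow>
           qcong V L (kashiwara_e n V i (bas y)) (scal V s (bas x))))"

definition crystal_graph_of :: "nat \<Rightarrow> 'v::ab_group_add qmodule \<Rightarrow> 'b crystal_data \<Rightarrow> bool" where
  "crystal_graph_of n V C \<longleftrightarrow>
     (\<exists>L bas. crystal_pseudobase n V L (verts C) (cr_wt C) bas \<and>
        (\<forall>i<n. \<forall>x\<in>verts C. \<forall>y\<in>verts C.
           (cr_f C i x = Some y \<longleftrightarrow>
              (\<exists>s\<in>{1, - 1}. qcong V L (kashiwara_f n V i (bas x)) (scal V s (bas y)))) \<and>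
           (cr_e C i x = Some y \<longleftrightarrow>
              (\<exists>s\<in>{1, - 1}. qcong V L (kashiwara_e n V i (bas x)) (scal V s (bas y))))))"


section \<open>The Kirillov--Reshetikhin crystal\<close>

definition restricts_to_CST :: "nat \<Rightarrow> nat \<Rightarrow> nat \<Rightarrow> filling crystal_data \<Rightarrow> bool" where
  "restricts_to_CST n k l C \<longleftrightarrow>
     verts C = CST n k l \<and>
     (\<forall>i\<in>{1..<n}. \<forall>b\<in>CST n k l.
        cr_e C i b = cst_e k l i b \<and> cr_f C i b = cst_f k l i b \<and>
        cr_wt C b i = int (mult i b) - int (mult (Suc i) b))"

text \<open>\<open>C\<close> is the crystal realized on column-strict tableaux, as the crystal graph of the module \<open>V\<close>.\<close>

definition KR_crystal ::
    "nat \<Rightarrow> nat \<Rightarrow> nat \<Rightarrow> 'v::ab_group_add qmodule \<Rightarrow> filling crystal_data \<Rightarrow> bool" where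
  "KR_crystal n k l V C \<longleftrightarrow>
     affine_crystal n C \<and> crystal_connected n C \<and>
     fd_Uq_module n V \<and> crystal_graph_of n V C \<and>
     restricts_to_CST n k l C"

end

theory Submission
  imports Defs
begin

text \<open>Why the rotation is promotion. Both \<open>\<psi> b\<close> and \<open>pr b\<close> are tableaux \<open>T\<close> of the following kind:
  \<open>T\<close> has as many letters \<open>1\<close> as \<open>b\<close> has letters \<open>n\<close>, and the operators of colours \<open>2, \<dots>, n - 1\<close> act on
  the letters \<open>2, \<dots>, n\<close> of \<open>T\<close> in the same way as those of colours \<open>1, \<dots>, n - 2\<close> act on the letters
  \<open>1, \<dots>, n - 1\<close> of \<open>b\<close>. There is only one such \<open>T\<close>. To see this, raise \<open>b\<close> and \<open>T\<close> in parallel until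
  neither can be raised. The tableau reached from \<open>T\<close> is of highest weight for the colours
  \<open>2, \<dots>, n - 1\<close>, and a rectangular tableau of this kind is determined by its number of ones
  (\<open>highest_weight_entry\<close>). Since \<open>\<psi> b\<close> is raised by the same colours to a tableau with the same number
  of ones, and raising is invertible, \<open>T = \<psi> b\<close> (\<open>raising_determines_rotation\<close>).

  For \<open>\<psi>\<close> the count of ones is a weight computation: \<open>\<psi>\<close> rotates weights, and the weights of a finite
  connected crystal have level zero (\<open>level_zero\<close>), so that \<open>\<psi>\<close> rotates the content of a tableau
  (\<open>mult_one_rotated\<close>).

  For \<open>pr\<close> the parallel action comes from Knuth equivalence of row words. It is a bisimulation for the
  raising operators (\<open>knuth_word_e\<close>), and a jeu de taquin slide stays in its class: a horizontal move
  does not change the word and a vertical move is \<open>knuth_vertical_slide\<close>. What remains is that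
  \<open>pr b\<close> is again a tableau of rectangular shape, that is, that every slide ends in the top row. The
  first slide cannot end elsewhere, and each path leaves behind a barrier (\<open>ladder\<close>) that
  keeps the next path to its right (\<open>slide_visible\<close>).\<close>

section \<open>Raising operators on words\<close>

text \<open>The number of signs \<open>-\<close> left in the signature of \<open>w @ v\<close>, if \<open>m\<close> of them are left in that of \<open>v\<close>. The
  parameter \<open>m\<close>, here and in \<open>word_e\<close>, describes the word to the right. It makes both functions
  compatible with concatenation, so that replacing a factor can be analysed on that factor alone.\<close>

fun unmatched :: "nat \<Rightarrow> nat list \<Rightarrow> nat \<Rightarrow> nat" where
  "unmatched i [] m = m"
| "unmatched i (a # w) m =
     (if a = i then Suc (unmatched i w m)
      else if a = Suc i then unmatched i w m - 1
      else unmatched i w m)"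

fun word_e :: "nat \<Rightarrow> nat list \<Rightarrow> nat \<Rightarrow> nat list option" where
  "word_e i [] m = None"
| "word_e i (a # w) m =
     (if a = Suc i \<and> unmatched i w m = 0 then Some (i # w)
      else map_option ((#) a) (word_e i w m))"

lemma unmatched_append: "unmatched i (u @ v) m = unmatched i u (unmatched i v m)"
  by (induction u) auto

text \<open>The tensor product rule.\<close>

lemma word_e_append:
  "word_e i (u @ v) m =
     (case word_e i u (unmatched i v m) of
        Some u' \<Rightarrow> Some (u' @ v)
      | None \<Rightarrow> map_option ((@) u) (word_e i v m))"
proof (induction u)
  case Nil
  then show ?case by (cases "word_e i v m") simp_all
next
  case (Cons a u)
  then show ?case
    by (cases "word_e i v m") (auto simp: unmatched_append split: option.splits)
qed

lemma word_e_filter: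
  assumes "P i" "P (Suc i)"
  shows "word_e i (filter P w) m = map_option (filter P) (word_e i w m)"
proof -
  have *: "unmatched i (filter P v) m = unmatched i v m" for v
    using assms by (induction v) auto
  show ?thesis
    using assms by (induction w) (auto simp: * option.map_comp comp_def intro!: option.map_cong)
qed

lemma word_e_map_Suc: "word_e (Suc i) (map Suc w) m = map_option (map Suc) (word_e i w m)"
proof -
  have *: "unmatched (Suc i) (map Suc v) m = unmatched i v m" for v
    by (induction v) auto
  show ?thesis
    by (induction w) (auto simp: * option.map_comp comp_def)
qed

lemma word_e_filter_out:
  assumes "word_e i w m = Some w'" "\<not> P i" "\<not> P (Suc i)"
  shows "filter P w' = filter P w"
  using assms by (induction w arbitrary: w') (auto split: if_splits)

lemma word_e_sum_list: "word_e i w m = Some w' \<Longrightarrow> sum_list w' < sum_list w"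
  by (induction w arbitrary: w') (auto split: if_splits)

text \<open>Without a raisable letter every \<open>+\<close> is matched, so the signs \<open>-\<close> outnumber the signs \<open>+\<close> by the
  unmatched ones.\<close>

lemma word_e_None_count:
  assumes "word_e i w 0 = None"
  shows "unmatched i w 0 + count_list w (Suc i) = count_list w i"
  using assms by (induction w) (auto split: if_splits)

text \<open>Cancellation of a \<open>+\<close> only involves letters to its right, so each \<open>+\<close> of a suffix is still matched.\<close>

lemma word_e_None_suffix:
  assumes "word_e i (u @ v) 0 = None"
  shows "count_list v (Suc i) \<le> count_list v i"
proof -
  have "word_e i v 0 = None"
    using assms by (auto simp: word_e_append split: option.splits)
  then show ?thesis
    using word_e_None_count[of i v] by simp
qed

section \<open>Knuth equivalence\<close>

inductive knuth_triple :: "nat list \<Rightarrow> nat list \<Rightarrow> bool" where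
  "a < b \<Longrightarrow> b \<le> c \<Longrightarrow> knuth_triple [b, c, a] [b, a, c]"
| "a < b \<Longrightarrow> b \<le> c \<Longrightarrow> knuth_triple [b, a, c] [b, c, a]"
| "a \<le> b \<Longrightarrow> b < c \<Longrightarrow> knuth_triple [a, c, b] [c, a, b]"
| "a \<le> b \<Longrightarrow> b < c \<Longrightarrow> knuth_triple [c, a, b] [a, c, b]"

inductive knuth_step :: "nat list \<Rightarrow> nat list \<Rightarrow> bool" where
  "knuth_triple x y \<Longrightarrow> knuth_step (u @ x @ v) (u @ y @ v)"

abbreviation knuth :: "nat list \<Rightarrow> nat list \<Rightarrow> bool" (infix "\<simeq>" 50) where
  "knuth \<equiv> knuth_step\<^sup>*\<^sup>*"

lemma knuth_triple_iff:
  "knuth_triple [x, y, z] [x', y', z'] \<longleftrightarrow>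
     x' = x \<and> y' = z \<and> z' = y \<and> (z < x \<and> x \<le> y \<or> y < x \<and> x \<le> z) \<or>
     x' = y \<and> y' = x \<and> z' = z \<and> (x \<le> z \<and> z < y \<or> y \<le> z \<and> z < x)"
  by (subst knuth_triple.simps) auto

lemma knuth_triple_sym: "knuth_triple x y \<Longrightarrow> knuth_triple y x"
  by (auto elim!: knuth_triple.cases intro: knuth_triple.intros)

lemma knuth_sym: "x \<simeq> y \<Longrightarrow> y \<simeq> x"
proof (rule sympD[OF symp_rtranclp])
  show "symp knuth_step"
    by (rule sympI) (auto elim!: knuth_step.cases intro: knuth_step.intros knuth_triple_sym)
qed 

lemma knuth_context: "x \<simeq> y \<Longrightarrow> u @ x @ v \<simeq> u @ y @ v"
proof (induction rule: rtranclp_induct)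
  case (step y z)
  then obtain x1 x2 p s where "knuth_triple x1 x2" "y = p @ x1 @ s" "z = p @ x2 @ s"
    by (auto elim: knuth_step.cases)
  then have "knuth_step (u @ y @ v) (u @ z @ v)"
    using knuth_step.intros[of x1 x2 "u @ p" "s @ v"] by simp
  with step.IH show ?case by simp
qed simp

lemma knuth_prefix: "x \<simeq> y \<Longrightarrow> u @ x \<simeq> u @ y"
  using knuth_context[of x y u "[]"] by simp

lemma knuth_suffix: "x \<simeq> y \<Longrightarrow> x @ v \<simeq> y @ v"
  using knuth_context[of x y "[]" v] by simp

lemma knuth_triple_unmatched: "knuth_triple x y \<Longrightarrow> unmatched i x m = unmatched i y m"
  by (erule knuth_triple.cases) auto

lemma knuth_triple_word_e:
  "knuth_triple x y \<Longrightarrow> rel_option knuth_triple (word_e i x m) (word_e i y m)"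
  by (erule knuth_triple.cases) (auto simp: knuth_triple_iff)

text \<open>The operator picks its factor by comparing numbers of unmatched signs, which a Knuth relation does
  not change. So it acts on both words in the same factor, and it is enough to look at the three
  letters themselves.\<close>

lemma knuth_step_word_e:
  assumes "knuth_step x y"
  shows "rel_option knuth_step (word_e i x m) (word_e i y m)"
  using assms
proof cases
  case (1 a b u v)
  let ?m = "unmatched i v m"
  from 1 have eq: "unmatched i a ?m = unmatched i b ?m"
    and rel: "rel_option knuth_triple (word_e i a ?m) (word_e i b ?m)"
    using knuth_triple_unmatched knuth_triple_word_e by blast+
  have tr: "knuth_step (p @ a @ s) (p @ b @ s)" for p s
    using 1 by (auto intro: knuth_step.intros)
  show ?thesis
  proof (cases "word_e i u (unmatched i a ?m)")
    case (Some u')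
    then show ?thesis
      using 1 eq tr by (simp add: word_e_append unmatched_append)
  next
    case None
    from rel show ?thesis
    proof cases
      case rel_None: None
      then show ?thesis
        using 1 eq tr \<open>word_e i u _ = None\<close>
        by (cases "word_e i v m") (simp_all add: word_e_append unmatched_append)
    next
      case rel_Some: (Some a' b')
      then show ?thesis
        using 1 eq \<open>word_e i u _ = None\<close>
        by (simp add: word_e_append unmatched_append knuth_step.intros)
    qed
  qed
qed

text \<open>Knuth equivalence is a bisimulation for the raising operators.\<close>

lemma knuth_word_e:
  assumes "x \<simeq> y"
  shows "rel_option knuth (word_e i x m) (word_e i y m)"
  using assms
proof (induction rule: rtranclp_induct)
  case base
  then show ?case by (simp add: option.rel_refl)
next
  case (step y z)
  from step.IH knuth_step_word_e[OF step.hyps(2), of i m] show ?case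
    by (auto simp: option_rel_Some1 option_rel_Some2 elim!: option.rel_cases)
qed

text \<open>A Knuth relation moves the extreme letters of a triple past each other, with the middle one as a
  witness. Restriction to an interval either keeps the witness or removes one of the extreme letters,
  and then both sides become equal.\<close>

lemma knuth_filter_interval:
  assumes "x \<simeq> y"
  shows "filter (\<lambda>a. lo < a \<and> a < hi) x \<simeq> filter (\<lambda>a. lo < a \<and> a < hi) y"
  using assms
proof (induction rule: rtranclp_induct)
  case (step y z)
  let ?F = "filter (\<lambda>a. lo < a \<and> a < hi)"
  from step.hyps obtain a b u v where "knuth_triple a b" "y = u @ a @ v" "z = u @ b @ v"
    by (auto elim: knuth_step.cases)
  moreover from \<open>knuth_triple a b\<close> have "?F a = ?F b \<or> knuth_triple (?F a) (?F b)"
    by cases (auto simp: knuth_triple_iff)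
  ultimately have "?F y = ?F z \<or> knuth_step (?F y) (?F z)"
    by (auto intro: knuth_step.intros)
  with step.IH show ?case by (auto intro: rtranclp.rtrancl_into_rtrancl)
qed simp

lemma knuth_map_Suc: "x \<simeq> y \<Longrightarrow> map Suc x \<simeq> map Suc y"
proof (induction rule: rtranclp_induct)
  case (step y z)
  from step.hyps obtain a b u v where "knuth_triple a b" "y = u @ a @ v" "z = u @ b @ v"
    by (auto elim: knuth_step.cases)
  moreover from \<open>knuth_triple a b\<close> have "knuth_triple (map Suc a) (map Suc b)"
    by cases (auto intro: knuth_triple.intros)
  ultimately have "knuth_step (map Suc y) (map Suc z)"
    by (auto intro: knuth_step.intros)
  with step.IH show ?case by simp
qed simp

lemma knuth_move_small_left:
  assumes "sorted (b # t)" "a < b"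
  shows "b # t @ [a] \<simeq> b # a # t"
  using assms
proof (induction t arbitrary: b)
  case (Cons c t)
  have "c # t @ [a] \<simeq> c # a # t"
    using Cons.prems by (intro Cons.IH) auto
  then have "b # c # t @ [a] \<simeq> b # c # a # t"
    using knuth_prefix[of _ _ "[b]"] by simp
  also have "b # c # a # t \<simeq> b # a # c # t"
    using knuth_step.intros[of "[b, c, a]" "[b, a, c]" "[]" t] Cons.prems
    by (auto intro: knuth_triple.intros)
  finally show ?case by simp
qed simp

lemma knuth_move_large_left:
  assumes "sorted (y @ [a])" "a < b"
  shows "y @ [b, a] \<simeq> b # y @ [a]"
  using assms
proof (induction y arbitrary: a rule: rev_induct)
  case (snoc c y)
  have le: "c \<le> a" "c < b"
    using snoc.prems by (auto simp: sorted_append)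
  have "y @ [c, b, a] \<simeq> y @ [b, c, a]"
    using knuth_step.intros[of "[c, b, a]" "[b, c, a]" y "[]"] le snoc.prems
    by (auto intro: knuth_triple.intros)
  also have "y @ [b, c, a] \<simeq> b # y @ [c, a]"
    using knuth_suffix[OF snoc.IH[of c], of "[a]"] snoc.prems le by (simp add: sorted_append)
  finally show ?case by simp
qed simp

text \<open>Row insertion: \<open>a\<close> bumps \<open>b\<close>, the leftmost letter of the row that exceeds it.\<close>

lemma knuth_bump:
  assumes "sorted (y @ b # t)" "sorted (y @ [a])" "a < b"
  shows "y @ b # t @ [a] \<simeq> b # y @ a # t"
proof -
  have "y @ b # t @ [a] \<simeq> y @ b # a # t"
    using knuth_move_small_left[of b t a] assms knuth_prefix by (auto simp: sorted_append)
  also have "\<dots> \<simeq> b # y @ a # t"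
    using knuth_suffix[OF knuth_move_large_left[of y a b], of t] assms by simp
  finally show ?thesis .
qed

text \<open>Successive insertion of a row \<open>s\<close> that fits above the segment \<open>z\<close>: each letter bumps the one below
  it.\<close>

lemma knuth_bump_row:
  assumes "sorted (y @ z @ t)" "sorted (y @ s)" "list_all2 (<) s z"
  shows "y @ z @ t @ s \<simeq> z @ y @ s @ t"
  using assms(3,1,2)
proof (induction arbitrary: y rule: list_all2_induct)
  case (Cons a s b z)
  have sorted: "sorted ((y @ [a]) @ z @ t)" "sorted ((y @ [a]) @ s)"
    using Cons.prems \<open>a < b\<close> by (auto simp: sorted_append intro: le_trans[of a b])
  have "y @ b # (z @ t) @ [a] \<simeq> b # y @ a # z @ t"
    using Cons by (intro knuth_bump) (auto simp: sorted_append)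
  from knuth_suffix[OF this, of s]
  have "y @ (b # z) @ t @ a # s \<simeq> [b] @ ((y @ [a]) @ z @ t @ s)" by simp
  also have "\<dots> \<simeq> [b] @ (z @ (y @ [a]) @ s @ t)"
    using sorted by (rule knuth_prefix[OF Cons.IH])
  finally show ?case by simp
qed simp

text \<open>The letter \<open>a\<close> moves down through the hole between \<open>x\<close> and \<open>u\<close>. On the right-hand side the
  letters of \<open>v\<close> bump those of \<open>x\<close> out of the row \<open>x a u\<close>, and the letters of \<open>w\<close> bump those of \<open>u\<close> out
  of the resulting row \<open>v a u\<close>. The letter \<open>a\<close> is never bumped, and the result is the left-hand side.\<close>

lemma knuth_vertical_slide:
  assumes "sorted (x @ a # u)" "sorted (v @ a # w)" "list_all2 (<) v x" "list_all2 (<) w u"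
  shows "x @ u @ v @ a # w \<simeq> x @ a # u @ v @ w"
proof -
  have sorted: "sorted ((v @ [a]) @ u @ [])" "sorted ((v @ [a]) @ w)"
    using assms(1,2) by (auto simp: sorted_append intro: le_trans[of _ a])
  have 1: "x @ (a # u) @ v \<simeq> x @ v @ a # u"
    using knuth_bump_row[of "[]" x "a # u" v] assms by (simp add: sorted_append)
  have 2: "(v @ [a]) @ u @ [] @ w \<simeq> u @ (v @ [a]) @ w @ []"
    by (rule knuth_bump_row[OF sorted assms(4)])
  have "x @ a # u @ v @ w \<simeq> x @ v @ a # u @ w"
    using knuth_suffix[OF 1, of w] by simp
  also have "\<dots> \<simeq> x @ u @ v @ a # w"
    using knuth_prefix[OF 2, of x] by simp
  finally show ?thesis by (rule knuth_sym)
qed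

section \<open>Row words of fillings\<close>

definition word :: "nat \<Rightarrow> nat \<Rightarrow> filling \<Rightarrow> nat list" where
  "word k l T = List.map_filter T (reading k l)"

lemma set_reading: "set (reading k l) = rect k l"
  by (force simp: reading_def rect_def simp del: upt_Suc)

lemma reading_Suc: "reading (Suc k) l = map (Pair (Suc k)) [1..<Suc l] @ reading k l"
  by (simp add: reading_def)

lemma distinct_reading: "distinct (reading k l)"
  by (induction k)
     (auto simp: reading_Suc distinct_map inj_on_def set_reading rect_def simp del: upt_Suc,
      simp add: reading_def)

lemma count_list_map_filter:
  "distinct cs \<Longrightarrow> count_list (List.map_filter T cs) a = card {p \<in> set cs. T p = Some a}"
proof (induction cs)
  case (Cons x cs)
  have "{p \<in> set (x # cs). T p = Some a} =
      (if T x = Some a then insert x {p \<in> set cs. T p = Some a} else {p \<in> set cs. T p = Some a})"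
    by auto
  with Cons show ?case by (auto split: option.splits)
qed simp

lemma mult_eq_count:
  assumes "dom T \<subseteq> rect k l"
  shows "mult a T = count_list (word k l T) a"
proof -
  have "{p. T p = Some a} = {p \<in> rect k l. T p = Some a}"
    using assms by auto
  then show ?thesis
    by (simp add: mult_def word_def count_list_map_filter distinct_reading set_reading)
qed

lemma cancel_minus_plus: "cancel s = filter (\<lambda>x. \<not> snd x) (cancel s) @ filter snd (cancel s)"
proof -
  have "\<exists>M P. cancel s = M @ P \<and> (\<forall>y\<in>set M. \<not> snd y) \<and> (\<forall>y\<in>set P. snd y)"
  proof (induction s)
    case (Cons x s)
    then obtain M P where MP: "cancel s = M @ P" "\<forall>y\<in>set M. \<not> snd y" "\<forall>y\<in>set P. snd y"
      by blast
    show ?case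
    proof (cases "snd x")
      case True
      then show ?thesis
        using MP by (intro exI[of _ "tl M"] exI[of _ "if M = [] then x # P else P"])
          (cases M; cases P; auto)
    next
      case False
      then show ?thesis
        using MP by (intro exI[of _ "x # M"] exI[of _ P]) (auto split: list.splits)
    qed
  qed simp
  then show ?thesis by (metis append_Nil2 filter_append filter_False filter_True append_Nil)
qed

text \<open>The cancelled word has the form \<open>-\<dots>-+\<dots>+\<close>. So a new \<open>+\<close> in front removes the first \<open>-\<close>, if there is one.\<close>

lemma filter_cancel_Cons:
  "filter (\<lambda>x. \<not> snd x) (cancel (x # s)) =
     (if snd x then tl (filter (\<lambda>x. \<not> snd x) (cancel s)) else x # filter (\<lambda>x. \<not> snd x) (cancel s))"
  "filter snd (cancel (x # s)) =
     (if snd x \<and> filter (\<lambda>x. \<not> snd x) (cancel s) = [] then x # filter snd (cancel s)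
      else filter snd (cancel s))"
proof -
  define M P where "M = filter (\<lambda>x. \<not> snd x) (cancel s)" and "P = filter snd (cancel s)"
  have eq: "cancel s = M @ P" and "\<forall>y\<in>set M. \<not> snd y" "\<forall>y\<in>set P. snd y"
    using cancel_minus_plus[of s] by (auto simp: M_def P_def)
  then have fl: "filter (\<lambda>x. \<not> snd x) P = []" "filter snd M = []"
    "filter (\<lambda>x. \<not> snd x) M = M" "filter snd P = P"
    by (auto simp: filter_empty_conv)
  show "filter (\<lambda>x. \<not> snd x) (cancel (x # s)) =
     (if snd x then tl (filter (\<lambda>x. \<not> snd x) (cancel s)) else x # filter (\<lambda>x. \<not> snd x) (cancel s))"
  "filter snd (cancel (x # s)) =
     (if snd x \<and> filter (\<lambda>x. \<not> snd x) (cancel s) = [] then x # filter snd (cancel s)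
      else filter snd (cancel s))"
    using fl \<open>\<forall>y\<in>set M. \<not> snd y\<close> \<open>\<forall>y\<in>set P. snd y\<close>
    unfolding M_def[symmetric] P_def[symmetric] cancel.simps
    by (cases M; cases P; auto simp: eq)+
qed

text \<open>The signature along an arbitrary list of cells, as is needed for induction on the reading order.\<close>

definition cell_signature :: "nat \<Rightarrow> filling \<Rightarrow> cell list \<Rightarrow> (cell \<times> bool) list" where
  "cell_signature i T cs = [(p, T p = Some (Suc i)). p \<leftarrow> cs, T p = Some i \<or> T p = Some (Suc i)]"

lemma length_minus_unmatched:
  "length (filter (\<lambda>x. \<not> snd x) (cancel (cell_signature i T cs))) =
     unmatched i (List.map_filter T cs) 0"
  by (induction cs)
     (auto simp: cell_signature_def filter_cancel_Cons
        simp del: cancel.simps(2) split: option.splits)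

text \<open>Distinctness of the cells matters: the operator on fillings changes a cell and the one on words a
  position.\<close>

lemma word_e_cell_signature:
  assumes "distinct cs"
  shows "case filter snd (cancel (cell_signature i T cs)) of
      [] \<Rightarrow> word_e i (List.map_filter T cs) 0 = None
    | x # _ \<Rightarrow> fst x \<in> set cs \<and>
        word_e i (List.map_filter T cs) 0 = Some (List.map_filter (T(fst x \<mapsto> i)) cs)"
  using assms
proof (induction cs)
  case Nil
  then show ?case by (simp add: cell_signature_def)
next
  case (Cons p cs)
  have *: "(filter (\<lambda>x. \<not> snd x) (cancel (cell_signature i T cs)) = []) =
      (unmatched i (List.map_filter T cs) 0 = 0)"
    using length_minus_unmatched[of i T cs] by (metis length_0_conv)
  have sig: "cell_signature i T (p # cs) =
    (if T p = Some i \<or> T p = Some (Suc i) then [(p, T p = Some (Suc i))] else []) @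
      cell_signature i T cs"
    by (simp add: cell_signature_def)
  have upd: "List.map_filter (T(p \<mapsto> i)) cs = List.map_filter T cs"
    using Cons.prems by (auto simp: List.map_filter_def intro!: map_cong filter_cong)
  show ?case
  proof (cases "T p = Some (Suc i) \<and> unmatched i (List.map_filter T cs) 0 = 0")
    case True
    then show ?thesis
      using * by (simp add: sig filter_cancel_Cons upd del: cancel.simps(2))
  next
    case False
    then have "filter snd (cancel (cell_signature i T (p # cs))) =
        filter snd (cancel (cell_signature i T cs))"
      using * by (auto simp: sig filter_cancel_Cons simp del: cancel.simps(2))
    moreover have "word_e i (List.map_filter T (p # cs)) 0 =
        map_option (\<lambda>w. (case T p of None \<Rightarrow> w | Some a \<Rightarrow> a # w))
          (word_e i (List.map_filter T cs) 0)"
      using False by (auto simp: option.map_ident split: option.splits)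
    ultimately show ?thesis
      using Cons
      by (auto simp: fun_upd_def split: list.splits option.splits)
  qed
qed

lemma cst_e_word: "map_option (word k l) (cst_e k l i T) = word_e i (word k l T) 0"
  using word_e_cell_signature[OF distinct_reading[of k l], of i T]
  by (auto simp: cst_e_def Let_def signature_def cell_signature_def[symmetric] word_def
      split: list.splits)

section \<open>Rectangular tableaux of highest weight\<close>

lemma reading_suffix:
  assumes "1 \<le> r" "r \<le> k" "1 \<le> c" "c \<le> l"
  shows "\<exists>u. reading k l = u @ map (Pair r) [c..<Suc l] @ reading (r - 1) l"
proof -
  have "\<exists>u. reading k l = u @ reading r l"
    using \<open>r \<le> k\<close>
  proof (induction k)
    case (Suc k)
    then show ?case
      by (cases "r = Suc k") (auto simp: reading_Suc simp del: upt_Suc)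
  qed (simp add: reading_def)
  then obtain u where "reading k l = u @ reading r l" by blast
  moreover have "[1..<Suc l] = [1..<c] @ [c..<Suc l]"
    using assms by (metis le_add_diff_inverse upt_add_eq_append le_Suc_eq)
  moreover have "reading r l = map (Pair r) [1..<Suc l] @ reading (r - 1) l"
    using reading_Suc[of "r - 1" l] assms by simp
  ultimately show ?thesis by (auto simp del: upt_Suc)
qed

lemma CST_word:
  assumes "T \<in> CST n k l"
  shows "word k l T = map (\<lambda>p. the (T p)) (reading k l)"
proof -
  have "p \<in> set (reading k l) \<Longrightarrow> T p \<noteq> None" for p
    using assms by (auto simp: CST_def set_reading)
  then have "filter (\<lambda>p. T p \<noteq> None) (reading k l) = reading k l"
    by (simp add: filter_id_conv)
  then show ?thesis by (simp add: word_def List.map_filter_def comp_def)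
qed

lemma CST_entry:
  assumes "T \<in> CST n k l" "p \<in> rect k l"
  shows "T p = Some (the (T p))"
proof -
  have "p \<in> dom T"
    using assms by (simp add: CST_def)
  then show ?thesis by auto
qed

lemma CST_entry_bounds:
  assumes "T \<in> CST n k l" "p \<in> rect k l"
  shows "1 \<le> the (T p)" "the (T p) \<le> n"
proof -
  have "the (T p) \<in> ran T"
    using CST_entry[OF assms] by (rule ranI)
  moreover have "ran T \<subseteq> {1..n}"
    using assms by (simp add: CST_def)
  ultimately show "1 \<le> the (T p)" "the (T p) \<le> n"
    by auto
qed

lemma CST_row:
  assumes T: "T \<in> CST n k l" and "(r, c) \<in> rect k l" "(r, c') \<in> rect k l" "c \<le> c'"
  shows "the (T (r, c)) \<le> the (T (r, c'))"
  using assms(4,2,3)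
proof (induction c' rule: dec_induct)
  case (step m)
  then have "(r, m) \<in> rect k l"
    by (auto simp: rect_def)
  with step T have "the (T (r, m)) \<le> the (T (r, Suc m))"
    by (auto simp: CST_def)
  with step \<open>(r, m) \<in> rect k l\<close> show ?case by simp
qed simp

lemma CST_column:
  assumes T: "T \<in> CST n k l" and "(r, c) \<in> rect k l" "(r', c) \<in> rect k l" "r < r'"
  shows "the (T (r, c)) < the (T (r', c))"
  using Suc_leI[OF assms(4)] assms(2,3)
proof (induction r' rule: dec_induct)
  case base
  then show ?case using T by (auto simp: CST_def)
next
  case (step m)
  then have "(m, c) \<in> rect k l"
    by (auto simp: rect_def)
  with step T have "the (T (m, c)) < the (T (Suc m, c))"
    by (auto simp: CST_def)
  with step \<open>(m, c) \<in> rect k l\<close> show ?case by simp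
qed

lemma count_list_map_zero: "\<forall>p\<in>set ps. f p \<noteq> a \<Longrightarrow> count_list (map f ps) a = 0"
  by (simp add: count_list_0_iff image_iff) metis

text \<open>Used for the columns in which the top row of a tableau has the letter \<open>1\<close>.\<close>

lemma down_closed_interval:
  assumes "A \<subseteq> {1..l}" "\<And>c c'. c' \<in> A \<Longrightarrow> 1 \<le> c \<Longrightarrow> c \<le> c' \<Longrightarrow> c \<in> A"
  shows "A = {1..card A}"
proof (cases "A = {}")
  case False
  have fin: "finite A"
    using assms(1) finite_subset by blast
  have "A = {1..Max A}"
  proof (intro equalityI subsetI)
    fix c assume "c \<in> A"
    then show "c \<in> {1..Max A}"
      using assms(1) Max_ge[OF fin] by auto
  next
    fix c assume "c \<in> {1..Max A}"
    then show "c \<in> A"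
      using assms(2)[OF Max_in[OF fin False], of c] by auto
  qed
  then show ?thesis by (metis card_atLeastAtMost diff_Suc_1)
qed simp

lemma CST_ones:
  assumes T: "T \<in> CST n k l" and "1 \<le> k" "1 \<le> c" "c \<le> l"
  shows "the (T (1, c)) = 1 \<longleftrightarrow> c \<le> mult 1 T"
proof -
  define A where "A = {c \<in> {1..l}. the (T (1, c)) = 1}"
  have "p \<in> Pair 1 ` A" if p: "T p = Some 1" for p
  proof -
    obtain r c where rc: "p = (r, c)" by force
    have mem: "(r, c) \<in> rect k l"
      using p T rc by (auto simp: CST_def)
    have "r = 1"
    proof (rule ccontr)
      assume "r \<noteq> 1"
      with mem have "(1, c) \<in> rect k l" "1 < r"
        by (auto simp: rect_def)
      then have "the (T (1, c)) < the (T (r, c))" "1 \<le> the (T (1, c))"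
        using CST_column[OF T _ mem] CST_entry_bounds[OF T] by auto
      with p rc show False by simp
    qed
    with mem p rc show ?thesis by (auto simp: A_def rect_def)
  qed
  moreover have "T p = Some 1" if "p \<in> Pair 1 ` A" for p
    using that CST_entry[OF T, of p] \<open>1 \<le> k\<close> by (auto simp: A_def rect_def)
  ultimately have "{p. T p = Some 1} = Pair 1 ` A" by blast
  then have card: "mult 1 T = card A"
    by (simp add: mult_def card_image inj_on_def)
  have "A = {1..card A}"
  proof (rule down_closed_interval)
    show "A \<subseteq> {1..l}" by (auto simp: A_def)
    fix c c' assume "c' \<in> A" "1 \<le> c" "c \<le> c'"
    then have "the (T (1, c)) \<le> the (T (1, c'))" "1 \<le> the (T (1, c))"
      using CST_row[OF T, of 1 c c'] CST_entry_bounds[OF T, of "(1, c)"] \<open>1 \<le> k\<close>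
      by (auto simp: A_def rect_def)
    with \<open>c' \<in> A\<close> \<open>1 \<le> c\<close> \<open>c \<le> c'\<close> show "c \<in> A"
      by (auto simp: A_def)
  qed
  then have "c \<in> A \<longleftrightarrow> 1 \<le> c \<and> c \<le> mult 1 T"
    unfolding card by (metis atLeastAtMost_iff)
  with assms show ?thesis by (auto simp: A_def)
qed

text \<open>The rows are forced one after another from the top. A letter above \<open>r + 1\<close> at the end of row \<open>r\<close> would
  violate the lattice condition, as its predecessor does not occur in the rows above. Strictness of the
  columns then leaves \<open>r + 1\<close> in the columns without a \<open>1\<close>. These columns already use up all the letters
  \<open>r\<close> of the rows above, so \<open>r + 1\<close> cannot occur in a further column.\<close>

lemma highest_weight_entry:
  assumes T: "T \<in> CST n k l" and l: "1 \<le> l"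
    and highest: "\<And>i. 2 \<le> i \<Longrightarrow> i < n \<Longrightarrow> word_e i (word k l T) 0 = None"
    and "1 \<le> r" "r \<le> k" "1 \<le> c" "c \<le> l"
  shows "the (T (r, c)) = (if c \<le> mult 1 T then r else Suc r)"
  using assms(4-)
proof (induction r arbitrary: c rule: less_induct)
  case (less r)
  define t where "t = (\<lambda>p. the (T p))"
  define m where "m = mult 1 T"
  have mem: "(r, c) \<in> rect k l" if "1 \<le> c" "c \<le> l" for c
    using that less.prems by (auto simp: rect_def)
  have known: "t (r', c) = (if c \<le> m then r' else Suc r')"
    if "1 \<le> r'" "r' < r" "1 \<le> c" "c \<le> l" for r' c
    using less.IH[of r' c] that less.prems by (auto simp: t_def m_def)
  have count_le: "count_list (map (\<lambda>c. t (r, c)) [c..<Suc l] @ map t (reading (r - 1) l)) (Suc i)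
      \<le> count_list (map (\<lambda>c. t (r, c)) [c..<Suc l] @ map t (reading (r - 1) l)) i"
    if c: "1 \<le> c" "c \<le> l" and i: "2 \<le> i" "i < n" for c i
  proof -
    obtain u where "reading k l = u @ map (Pair r) [c..<Suc l] @ reading (r - 1) l"
      using reading_suffix c less.prems by blast
    then have "word k l T =
        map t u @ (map (\<lambda>c. t (r, c)) [c..<Suc l] @ map t (reading (r - 1) l))"
      by (simp add: CST_word[OF T] t_def comp_def del: upt_Suc)
    then show ?thesis
      using word_e_None_suffix highest[OF i] by metis
  qed
  have above_le: "t p \<le> r" if "p \<in> set (reading (r - 1) l)" for p
  proof -
    obtain r' c' where p: "p = (r', c')" by force
    with that have "1 \<le> r'" "r' < r" "1 \<le> c'" "c' \<le> l"
      using less.prems by (auto simp: set_reading rect_def)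
    then show ?thesis using known[of r' c'] by (simp add: p)
  qed
  have upper: "t (r, c) \<le> Suc r" if c: "1 \<le> c" "c \<le> l" for c
  proof (rule ccontr)
    assume "\<not> t (r, c) \<le> Suc r"
    then have big: "Suc (Suc r) \<le> t (r, l)"
      using CST_row[OF T mem[OF c] mem[OF l order.refl] c(2)] by (simp add: t_def)
    define i where "i = t (r, l) - 1"
    have i: "t (r, l) = Suc i" "Suc r \<le> i"
      using big by (auto simp: i_def)
    moreover have "i < n"
      using CST_entry_bounds(2)[OF T mem[OF l order.refl]] i by (simp add: t_def)
    moreover have "count_list (map t (reading (r - 1) l)) i = 0"
      using above_le i by (intro count_list_map_zero) fastforce
    ultimately show False
      using count_le[of l i] l less.prems by simp
  qed
  have lower: "(if c \<le> m then r else Suc r) \<le> t (r, c)" if c: "1 \<le> c" "c \<le> l" for c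
  proof (cases "r = 1")
    case True
    then show ?thesis
      using CST_ones[OF T _ c] CST_entry_bounds(1)[OF T mem[OF c]] less.prems
      by (auto simp: t_def m_def)
  next
    case False
    then have "(r - 1, c) \<in> rect k l" "r - 1 < r"
      using c less.prems by (auto simp: rect_def)
    then have "t (r - 1, c) < t (r, c)"
      unfolding t_def by (intro CST_column[OF T _ mem[OF c]])
    then show ?thesis
      using known[of "r - 1" c] False less.prems c by (auto split: if_splits)
  qed
  show ?case
  proof (cases "c \<le> m \<and> t (r, c) = Suc r")
    case False
    then show ?thesis
      using upper[of c] lower[of c] less.prems by (auto simp: t_def m_def split: if_splits)
  next
    case True
    have r: "2 \<le> r"
    proof (rule ccontr)
      assume "\<not> 2 \<le> r"
      then have "r = 1" using less.prems by simp
      then show False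
        using CST_ones[OF T, of c] True less.prems by (auto simp: t_def m_def)
    qed
    have "r < n"
      using CST_entry_bounds(2)[OF T mem, of c] True less.prems by (simp add: t_def)
    have row: "t (r, c') = Suc r" if "c \<le> c'" "c' \<le> l" for c'
      using CST_row[OF T mem mem, of c c'] upper[of c'] True that less.prems
      by (simp add: t_def)
    have row_eq: "map (\<lambda>c. t (r, c)) [c..<Suc l] = replicate (Suc l - c) (Suc r)"
      using row by (intro replicate_eqI) auto
    have "reading (r - 1) l = map (Pair (r - 1)) [1..<Suc l] @ reading (r - 2) l"
      using reading_Suc[of "r - 2" l] r by (simp add: numeral_2_eq_2 Suc_diff_Suc)
    moreover have "count_list (map t (reading (r - 2) l)) r = 0"
    proof (intro count_list_map_zero ballI)
      fix p assume "p \<in> set (reading (r - 2) l)"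
      moreover obtain r' c' where p: "p = (r', c')" by force
      ultimately have "1 \<le> r'" "r' < r - 1" "1 \<le> c'" "c' \<le> l"
        using r by (auto simp: set_reading rect_def)
      then show "t p \<noteq> r" using known[of r' c'] by (auto simp: p)
    qed
    moreover have "count_list (map (\<lambda>c. t (r - 1, c)) [1..<Suc l]) r = l - m"
    proof -
      have "map (\<lambda>c. t (r - 1, c)) [1..<Suc l] = map (\<lambda>c. if c \<le> m then r - 1 else r) [1..<Suc l]"
        using known[of "r - 1"] r by (intro map_cong) auto
      moreover have "count_list (map (\<lambda>c. if c \<le> m then r - 1 else r) [1..<Suc j]) r = j - m" for j
        using r by (induction j) auto
      ultimately show ?thesis by (simp only:)
    qed
    ultimately have "count_list (map t (reading (r - 1) l)) r = l - m"
      by (simp add: comp_def del: upt_Suc)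
    moreover have "count_list (replicate j x) y = (if x = y then j else 0)" for j and x y :: nat
      by (induction j) auto
    ultimately have "Suc l - c \<le> l - m"
      using count_le[of c r] r \<open>r < n\<close> less.prems by (simp add: row_eq del: upt_Suc)
    with True less.prems show ?thesis by auto
  qed
qed

section \<open>Slides\<close>

text \<open>The intermediate fillings of promotion are encoded as total functions on the rectangle: \<open>0\<close> marks
  the cells vacated so far and the current hole, \<open>N\<close> the cells of the strip that are still to be
  filled. In this way all rows have full length, the tableau conditions hold away from the hole, and
  skew shapes never appear.\<close>

definition visible :: "nat \<Rightarrow> nat \<Rightarrow> nat \<Rightarrow> (cell \<Rightarrow> nat) \<Rightarrow> filling" where
  "visible N k l g = (\<lambda>p. if p \<in> rect k l \<and> 0 < g p \<and> g p < N then Some (g p) else None)"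

text \<open>The tableau conditions between cells other than the hole \<open>h\<close>. A hole outside the rectangle, such as
  \<open>(0, 0)\<close>, gives the ordinary conditions.\<close>

definition tableau_off :: "nat \<Rightarrow> nat \<Rightarrow> cell \<Rightarrow> (cell \<Rightarrow> nat) \<Rightarrow> bool" where
  "tableau_off k l h g \<longleftrightarrow>
     (\<forall>r c c'. (r, c) \<in> rect k l \<and> (r, c') \<in> rect k l \<and> c < c' \<and> (r, c) \<noteq> h \<and> (r, c') \<noteq> h \<longrightarrow>
        g (r, c) \<le> g (r, c')) \<and>
     (\<forall>r r' c. (r, c) \<in> rect k l \<and> (r', c) \<in> rect k l \<and> r < r' \<and> (r, c) \<noteq> h \<and> (r', c) \<noteq> h \<longrightarrow>
        g (r, c) < g (r', c))"

text \<open>A barrier to the left of column \<open>c\<close> for a slide that is in row \<open>r\<close>. If the hole comes next to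
  \<open>(s, d s)\<close>, it sees above itself a letter at least as large as the one on its left, and so it
  moves up. In the next row it is still to the right of the barrier, which only recedes further up.
  The value \<open>d s = 0\<close> stands for the left border of the rectangle. Positivity ensures that the upper
  neighbour has not been vacated.\<close>

definition ladder :: "(cell \<Rightarrow> nat) \<Rightarrow> (nat \<Rightarrow> nat) \<Rightarrow> nat \<Rightarrow> nat \<Rightarrow> bool" where
  "ladder g d r c \<longleftrightarrow>
     (\<forall>s. 2 \<le> s \<and> s \<le> r \<longrightarrow> d s < c \<and> 0 < g (s - 1, Suc (d s)) \<and>
        (d s = 0 \<or> g (s, d s) \<le> g (s - 1, Suc (d s)))) \<and>
     (\<forall>s s'. 2 \<le> s \<and> s \<le> s' \<and> s' \<le> r \<longrightarrow> d s \<le> d s')"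

lemma ladder_fewer_rows: "ladder g d r c \<Longrightarrow> r' \<le> r \<Longrightarrow> ladder g d r' c"
  unfolding ladder_def by (meson order_trans)

lemma tableau_offD:
  assumes "tableau_off k l h g"
  shows "1 \<le> r \<Longrightarrow> r \<le> k \<Longrightarrow> 1 \<le> c \<Longrightarrow> c < c' \<Longrightarrow> c' \<le> l \<Longrightarrow> (r, c) \<noteq> h \<Longrightarrow> (r, c') \<noteq> h \<Longrightarrow>
      g (r, c) \<le> g (r, c')"
    and "1 \<le> r \<Longrightarrow> r < r' \<Longrightarrow> r' \<le> k \<Longrightarrow> 1 \<le> c \<Longrightarrow> c \<le> l \<Longrightarrow> (r, c) \<noteq> h \<Longrightarrow> (r', c) \<noteq> h \<Longrightarrow>
      g (r, c) < g (r', c)"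
  using assms by (auto simp: tableau_off_def rect_def)

lemma tableau_offI:
  assumes "\<And>r c c'. 1 \<le> r \<Longrightarrow> r \<le> k \<Longrightarrow> 1 \<le> c \<Longrightarrow> c < c' \<Longrightarrow> c' \<le> l \<Longrightarrow> (r, c) \<noteq> h \<Longrightarrow>
      (r, c') \<noteq> h \<Longrightarrow> g (r, c) \<le> g (r, c')"
    and "\<And>r r' c. 1 \<le> r \<Longrightarrow> r < r' \<Longrightarrow> r' \<le> k \<Longrightarrow> 1 \<le> c \<Longrightarrow> c \<le> l \<Longrightarrow> (r, c) \<noteq> h \<Longrightarrow>
      (r', c) \<noteq> h \<Longrightarrow> g (r, c) < g (r', c)"
  shows "tableau_off k l h g"
  using assms by (auto simp: tableau_off_def rect_def)

lemma word_visible: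
  "word k l (visible N k l g) = filter (\<lambda>a. 0 < a \<and> a < N) (map g (reading k l))"
proof -
  have "List.map_filter (visible N k l g) ps = filter (\<lambda>a. 0 < a \<and> a < N) (map g ps)"
    if "set ps \<subseteq> rect k l" for ps
    using that by (induction ps) (auto simp: visible_def)
  then show ?thesis by (simp add: word_def set_reading)
qed

lemma upt_split_at: "1 \<le> c \<Longrightarrow> c \<le> l \<Longrightarrow> [1..<Suc l] = [1..<c] @ c # [Suc c..<Suc l]"
  using upt_add_eq_append[of 1 c "Suc l - c"] by (simp add: upt_conv_Cons del: upt_Suc)

lemma sorted_map_upt:
  assumes "\<And>i j. 1 \<le> i \<Longrightarrow> i < j \<Longrightarrow> j \<le> l \<Longrightarrow> f i \<le> f j"
  shows "sorted (map f [1..<Suc l])"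
  using assms by (auto simp: sorted_iff_nth_mono_less simp del: upt_Suc)

text \<open>Only \<open>0\<close> passes a letter, and it does not belong to the word.\<close>

lemma slide_left_word:
  assumes "1 \<le> r" "r \<le> k" "2 \<le> c" "c \<le> l" "g (r, c) = 0"
  shows "word k l (visible N k l (g((r, c) := g (r, c - 1), (r, c - 1) := 0))) =
    word k l (visible N k l g)"
proof -
  let ?g = "g((r, c) := g (r, c - 1), (r, c - 1) := 0)"
  obtain u where u: "reading k l = u @ map (Pair r) [c - 1..<Suc l] @ reading (r - 1) l"
    using reading_suffix[of r k "c - 1" l] assms by fastforce
  have "[c - 1..<Suc l] = (c - 1) # c # [Suc c..<Suc l]"
    using assms by (simp add: upt_conv_Cons del: upt_Suc)
  with u have "reading k l = u @ [(r, c - 1), (r, c)] @ map (Pair r) [Suc c..<Suc l] @ reading (r - 1) l"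
    by simp
  then obtain v where R: "reading k l = u @ [(r, c - 1), (r, c)] @ v"
    by blast
  have same: "map ?g ps = map g ps" if "(r, c - 1) \<notin> set ps" "(r, c) \<notin> set ps" for ps
    using that by (intro map_cong) auto
  have "distinct (reading k l)" by (rule distinct_reading)
  then have uv: "map ?g u = map g u" "map ?g v = map g v"
    unfolding R by (intro same; auto)+
  have "c - 1 \<noteq> c" using assms by simp
  then have "?g (r, c - 1) = 0" "?g (r, c) = g (r, c - 1)" by auto
  then have "map ?g (reading k l) = map g u @ [0, g (r, c - 1)] @ map g v"
    unfolding R map_append uv list.map by simp
  moreover have "map g (reading k l) = map g u @ [g (r, c - 1), 0] @ map g v"
    unfolding R map_append list.map assms by simp
  ultimately show ?thesis
    unfolding word_visible by simp
qed

text \<open>The vertical Knuth move is applied to the full rows, including the marks \<open>0\<close> and \<open>N\<close>. Restriction to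
  the interval of the real letters then gives the claim for the fillings.\<close>

lemma slide_up_word:
  assumes tab: "tableau_off k l (r, c) g" and tab': "tableau_off k l (r - 1, c) g'"
    and g': "g' = g((r, c) := g (r - 1, c), (r - 1, c) := 0)"
    and rc: "2 \<le> r" "r \<le> k" "1 \<le> c" "c \<le> l" and hole: "g (r, c) = 0"
  shows "word k l (visible N k l g) \<simeq> word k l (visible N k l g')"
proof -
  define L R where "L = [1..<c]" and "R = [Suc c..<Suc l]"
  have LR: "[1..<Suc l] = L @ c # R"
    using upt_split_at rc by (simp add: L_def R_def)
  have mem: "j \<in> set L \<longleftrightarrow> 1 \<le> j \<and> j < c" "j \<in> set R \<longleftrightarrow> c < j \<and> j \<le> l" for j
    by (auto simp: L_def R_def)
  define x u v w where "x = map (\<lambda>j. g (r, j)) L" and "u = map (\<lambda>j. g (r, j)) R"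
    and "v = map (\<lambda>j. g (r - 1, j)) L" and "w = map (\<lambda>j. g (r - 1, j)) R"
  define a where "a = g (r - 1, c)"
  obtain A where "reading k l = A @ map (Pair r) [1..<Suc l] @ reading (r - 1) l"
    using reading_suffix[of r k 1 l] rc by fastforce
  moreover define B where "B = reading (r - 2) l"
  moreover have "reading (r - 1) l = map (Pair (r - 1)) [1..<Suc l] @ reading (r - 2) l"
    using reading_Suc[of "r - 2" l] rc by (simp add: numeral_2_eq_2 Suc_diff_Suc)
  ultimately have reading: "reading k l =
      A @ map (Pair r) (L @ c # R) @ map (Pair (r - 1)) (L @ c # R) @ B"
    by (simp only: LR)
  have "distinct (reading k l)" by (rule distinct_reading)
  then have notin: "(r, c) \<notin> set A \<union> set B" "(r - 1, c) \<notin> set A \<union> set B"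
    unfolding reading by auto
  then have AB: "map g' A = map g A" "map g' B = map g B"
    unfolding g' by (intro map_cong; auto)+
  have row_r: "map (\<lambda>j. g' (r, j)) L = x" "map (\<lambda>j. g' (r, j)) R = u"
    and row_above: "map (\<lambda>j. g' (r - 1, j)) L = v" "map (\<lambda>j. g' (r - 1, j)) R = w"
    unfolding g' x_def u_def v_def w_def by (intro map_cong; auto simp: mem)+
  have vals: "g' (r, c) = a" "g' (r - 1, c) = 0"
    using rc by (auto simp: g' a_def)
  let ?F = "filter (\<lambda>a. 0 < a \<and> a < N)"
  have "map g (reading k l) = map g A @ (x @ 0 # u @ v @ a # w) @ map g B"
    by (simp add: reading x_def u_def v_def w_def a_def hole comp_def)
  then have F: "?F (map g (reading k l)) = ?F (map g A @ (x @ u @ v @ a # w) @ map g B)"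
    by (simp del: filter_map)
  have "map g' (reading k l) = map g A @ (x @ a # u @ v @ 0 # w) @ map g B"
    by (simp add: reading comp_def AB row_r row_above vals del: One_nat_def)
  then have F': "?F (map g' (reading k l)) = ?F (map g A @ (x @ a # u @ v @ w) @ map g B)"
    by (simp del: filter_map)
  have "x @ u @ v @ a # w \<simeq> x @ a # u @ v @ w"
  proof (rule knuth_vertical_slide)
    have "sorted (map (\<lambda>j. g' (r, j)) [1..<Suc l])"
      using rc by (intro sorted_map_upt tableau_offD(1)[OF tab']) auto
    then show "sorted (x @ a # u)"
      unfolding LR by (simp add: row_r vals)
    have "sorted (map (\<lambda>j. g (r - 1, j)) [1..<Suc l])"
      using rc by (intro sorted_map_upt tableau_offD(1)[OF tab]) auto
    then show "sorted (v @ a # w)"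
      unfolding LR by (simp add: v_def w_def a_def)
    show "list_all2 (<) v x"
      unfolding v_def x_def list_all2_map1 list_all2_map2 list_all2_same
      using rc mem by (intro ballI tableau_offD(2)[OF tab]) auto
    show "list_all2 (<) w u"
      unfolding w_def u_def list_all2_map1 list_all2_map2 list_all2_same
      using rc mem by (intro ballI tableau_offD(2)[OF tab]) auto
  qed
  from knuth_filter_interval[OF knuth_context[OF this, of "map g A" "map g B"], of 0 N]
  show ?thesis
    unfolding word_visible F F' .
qed

lemma card_zeros_move:
  assumes "finite A" "h \<in> A" "h' \<in> A" "g h = 0" "g h' \<noteq> (0 :: nat)"
  shows "card {p \<in> A. (g(h := g h', h' := 0)) p = 0} = card {p \<in> A. g p = 0}"
proof -
  have "{p \<in> A. (g(h := g h', h' := 0)) p = 0} = insert h' ({p \<in> A. g p = 0} - {h})"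
    using assms by auto
  moreover have "h' \<notin> {p \<in> A. g p = 0} - {h}" "h \<in> {p \<in> A. g p = 0}"
    using assms by auto
  ultimately show ?thesis
    using assms(1) card_Suc_Diff1[of "{p \<in> A. g p = 0}" h]
    by (simp del: card_Diff_insert card_Diff_singleton)
qed

lemma above_visible:
  "1 \<le> r \<Longrightarrow> r \<le> k \<Longrightarrow> 1 \<le> c \<Longrightarrow> c \<le> l \<Longrightarrow> above (visible N k l g) r c =
     (if 2 \<le> r \<and> 0 < g (r - 1, c) \<and> g (r - 1, c) < N then Some (g (r - 1, c)) else None)"
  by (auto simp: above_def visible_def rect_def)

lemma leftof_visible:
  "1 \<le> r \<Longrightarrow> r \<le> k \<Longrightarrow> 1 \<le> c \<Longrightarrow> c \<le> l \<Longrightarrow> leftof (visible N k l g) r c =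
     (if 2 \<le> c \<and> 0 < g (r, c - 1) \<and> g (r, c - 1) < N then Some (g (r, c - 1)) else None)"
  by (auto simp: leftof_def visible_def rect_def)

lemma finite_rect: "finite (rect k l)"
  by (simp add: rect_def)

text \<open>The state \<open>g'\<close> after a slide that starts at \<open>(r, c)\<close>, together with the barrier \<open>d'\<close> that it leaves for
  a slide starting further to the right.\<close>

definition slides_to ::
    "nat \<Rightarrow> nat \<Rightarrow> nat \<Rightarrow> (cell \<Rightarrow> nat) \<Rightarrow> nat \<Rightarrow> nat \<Rightarrow> (cell \<Rightarrow> nat) \<Rightarrow> (nat \<Rightarrow> nat) \<Rightarrow> bool" where
  "slides_to N k l g r c g' d' \<longleftrightarrow>
     slide (visible N k l g) r c = visible N k l g' \<and> tableau_off k l (0, 0) g' \<and>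
     (\<forall>s j. \<not> (s \<le> r \<and> j \<le> c) \<longrightarrow> g' (s, j) = g (s, j)) \<and>
     (\<forall>s j. 1 \<le> s \<and> s \<le> r \<and> 1 \<le> j \<and> j \<le> c \<longrightarrow> g' (s, j) < N) \<and>
     card {p \<in> rect k l. g' p = 0} = card {p \<in> rect k l. g p = 0} \<and>
     word k l (visible N k l g) \<simeq> word k l (visible N k l g') \<and>
     (\<forall>c2. c < c2 \<and> c2 \<le> l \<longrightarrow> ladder g' d' r c2)"

text \<open>Along the path the hole stays to the right of the given barrier, so it can always move up until it
  is in the top row. The new barrier consists of the cells where the path goes up. There
  \<open>(s, c)\<close> receives the letter of \<open>(s - 1, c)\<close>, which is at most its right neighbour \<open>(s - 1, c + 1)\<close>, and
  neither of the two cells \<open>(s, c)\<close> and \<open>(s - 1, c + 1)\<close> is visited again.\<close>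

lemma slide_visible:
  assumes "tableau_off k l (r, c) g" "1 \<le> r" "r \<le> k" "1 \<le> c" "c \<le> l" "g (r, c) = 0"
    and "\<And>s j. 1 \<le> s \<Longrightarrow> s \<le> r \<Longrightarrow> 1 \<le> j \<Longrightarrow> j \<le> c \<Longrightarrow> g (s, j) < N"
    and "\<And>s j. 2 \<le> s \<Longrightarrow> s \<le> k \<Longrightarrow> 1 \<le> j \<Longrightarrow> j \<le> l \<Longrightarrow> (s, j) \<noteq> (r, c) \<Longrightarrow> 0 < g (s, j)"
    and "ladder g d r c"
  shows "\<exists>g' d'. slides_to N k l g r c g' d'"
  using assms
proof (induction "r + c" arbitrary: g r c rule: less_induct)
  case less
  note tab = tableau_offD[OF less.prems(1)]
  note rc = less.prems(2-5) and hole = less.prems(6) and small = less.prems(7)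
    and pos = less.prems(8) and lad = less.prems(9)
  have mem: "(r, c) \<in> rect k l" using rc by (simp add: rect_def)
  have above_pos: "0 < g (r - 1, c)" if "2 \<le> r"
  proof -
    have d: "d r < c" "0 < g (r - 1, Suc (d r))"
      using lad that by (auto simp: ladder_def)
    have "g (r - 1, Suc (d r)) \<le> g (r - 1, c)"
      using tab(1)[of "r - 1" "Suc (d r)" c] d rc that by (cases "Suc (d r) = c") auto
    with d show ?thesis by simp
  qed
  have above: "above (visible N k l g) r c = (if 2 \<le> r then Some (g (r - 1, c)) else None)"
    using above_visible[OF rc] above_pos small[of "r - 1" c] rc by auto
  consider (up) "2 \<le> r" "c = 1 \<or> g (r, c - 1) \<le> g (r - 1, c)"
    | (left) "2 \<le> c" "0 < g (r, c - 1)" "2 \<le> r \<longrightarrow> g (r - 1, c) < g (r, c - 1)"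
    | (stop) "r = 1" "c = 1 \<or> g (r, c - 1) = 0"
  proof (cases "c = 1 \<or> g (r, c - 1) = 0")
    case True
    then show thesis
      using that(1,3) rc by (cases "r = 1") auto
  next
    case False
    then show thesis
      using that(1,2) rc by fastforce
  qed
  then show ?case
  proof cases
    case up
    let ?a = "g (r - 1, c)"
    define g1 where "g1 = g((r, c) := ?a, (r - 1, c) := 0)"
    have a: "0 < ?a" "?a < N"
      using above_pos up small[of "r - 1" c] rc by auto
    have mem': "(r - 1, c) \<in> rect k l" using up rc by (auto simp: rect_def)
    have g1_simps: "g1 (r, c) = ?a" "g1 (r - 1, c) = 0"
      "p \<noteq> (r, c) \<Longrightarrow> p \<noteq> (r - 1, c) \<Longrightarrow> g1 p = g p" for p
      using up by (auto simp: g1_def)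
    have left: "c = 1 \<or> leftof (visible N k l g) r c = Some (g (r, c - 1))"
    proof (cases "c = 1")
      case False
      then have "2 \<le> c" "0 < g (r, c - 1)" "g (r, c - 1) < N"
        using rc up by (auto intro!: pos small)
      then show ?thesis using leftof_visible[OF rc] by simp
    qed simp
    have "(visible N k l g)((r, c) := Some ?a, (r - 1, c) := None) = visible N k l g1"
      using a up mem by (auto simp: visible_def g1_def fun_eq_iff)
    then have slide: "slide (visible N k l g) r c = slide (visible N k l g1) (r - 1) c"
      using left up leftof_visible[OF rc] by (subst slide.simps) (auto simp: above)
    have tab1: "tableau_off k l (r - 1, c) g1"
    proof (rule tableau_offI)
      fix s j j' assume s: "1 \<le> s" "s \<le> k" "1 \<le> j" "j < j'" "j' \<le> l"
        "(s, j) \<noteq> (r - 1, c)" "(s, j') \<noteq> (r - 1, c)"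
      consider "(s, j) = (r, c)" | "(s, j') = (r, c)" | "(s, j) \<noteq> (r, c)" "(s, j') \<noteq> (r, c)"
        by blast
      then show "g1 (s, j) \<le> g1 (s, j')"
      proof cases
        case 1
        \<comment> \<open>The right neighbours in row \<open>r\<close> exceed the moved letter by way of the row above.\<close>
        have "?a \<le> g (r - 1, j')" "g (r - 1, j') < g (r, j')"
          using 1 s up rc by (auto intro!: tab)
        with 1 s show ?thesis by (simp add: g1_simps)
      next
        case 2
        have "g (r, j) \<le> g (r, c - 1)"
          using 2 s rc by (cases "j = c - 1") (auto intro!: tab(1))
        with 2 s up show ?thesis by (auto simp: g1_simps)
      next
        case 3
        with s show ?thesis using tab(1)[of s j j'] by (simp add: g1_simps)
      qed
    next
      fix s s' j assume s: "1 \<le> s" "s < s'" "s' \<le> k" "1 \<le> j" "j \<le> l"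
        "(s, j) \<noteq> (r - 1, c)" "(s', j) \<noteq> (r - 1, c)"
      consider "(s, j) = (r, c)" | "(s', j) = (r, c)" | "(s, j) \<noteq> (r, c)" "(s', j) \<noteq> (r, c)"
        by blast
      then show "g1 (s, j) < g1 (s', j)"
      proof cases
        case 1
        have "?a < g (s', c)"
          using 1 s up rc by (auto intro!: tab)
        with 1 s show ?thesis by (simp add: g1_simps)
      next
        case 2
        then have "s < r - 1" using s up by (cases "s = r - 1") auto
        have "g (s, c) < ?a"
          using 2 s \<open>s < r - 1\<close> up rc by (auto intro!: tab)
        with 2 s show ?thesis by (simp add: g1_simps)
      next
        case 3
        with s show ?thesis using tab(2)[of s s' j] by (simp add: g1_simps)
      qed
    qed
    have lad1: "ladder g1 d (r - 1) c"
    proof -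
      have "d s < c" if "2 \<le> s" "s \<le> r" for s
        using lad that by (auto simp: ladder_def)
      then have "g1 (s, d s) = g (s, d s)" "g1 (s - 1, Suc (d s)) = g (s - 1, Suc (d s))"
        if "2 \<le> s" "s \<le> r - 1" for s
        using that by (intro g1_simps(3); force)+
      then show ?thesis
        using ladder_fewer_rows[OF lad, of "r - 1"] by (simp add: ladder_def)
    qed
    have "\<exists>g' d'. slides_to N k l g1 (r - 1) c g' d'"
    proof (rule less.hyps[OF _ tab1 _ _ _ _ _ _ _ lad1])
      show "r - 1 + c < r + c" "1 \<le> r - 1" "r - 1 \<le> k" "1 \<le> c" "c \<le> l" "g1 (r - 1, c) = 0"
        using up rc g1_simps by auto
      show "g1 (s, j) < N" if "1 \<le> s" "s \<le> r - 1" "1 \<le> j" "j \<le> c" for s j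
        using that small[of s j] a by (auto simp: g1_def)
      show "0 < g1 (s, j)" if "2 \<le> s" "s \<le> k" "1 \<le> j" "j \<le> l" "(s, j) \<noteq> (r - 1, c)" for s j
        using that pos[of s j] a by (auto simp: g1_def)
    qed
    then obtain g' d' where g': "slide (visible N k l g1) (r - 1) c = visible N k l g'"
      "tableau_off k l (0, 0) g'"
      and outside: "\<And>s j. \<not> (s \<le> r - 1 \<and> j \<le> c) \<Longrightarrow> g' (s, j) = g1 (s, j)"
      and inside: "\<And>s j. 1 \<le> s \<and> s \<le> r - 1 \<and> 1 \<le> j \<and> j \<le> c \<Longrightarrow> g' (s, j) < N"
      and card: "card {p \<in> rect k l. g' p = 0} = card {p \<in> rect k l. g1 p = 0}"
      and wd: "word k l (visible N k l g1) \<simeq> word k l (visible N k l g')"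
      and lad': "\<And>c2. c < c2 \<and> c2 \<le> l \<Longrightarrow> ladder g' d' (r - 1) c2"
      unfolding slides_to_def by blast
    have "ladder g' (d'(r := c)) r c2" if c2: "c < c2" "c2 \<le> l" for c2
    proof -
      have d': "d' s \<le> c" if "2 \<le> s" "s \<le> r - 1" for s
        using lad'[of "Suc c"] c2 that by (auto simp: ladder_def)
      have "g' (r, c) = ?a" "g' (r - 1, Suc c) = g (r - 1, Suc c)"
        using outside[of r c] outside[of "r - 1" "Suc c"] up by (auto simp: g1_simps)
      moreover have "?a \<le> g (r - 1, Suc c)"
        using up rc c2 by (intro tab(1)) auto
      ultimately have new: "g' (r, c) \<le> g' (r - 1, Suc c)" "0 < g' (r - 1, Suc c)"
        using a by auto
      have old: "ladder g' d' (r - 1) c2" using lad' c2 by blast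
      have "s \<le> r - 1 \<longleftrightarrow> s \<le> r \<and> s \<noteq> r" for s using up by auto
      with old new d' c2 show ?thesis
        unfolding ladder_def by (auto simp del: One_nat_def)
    qed
    moreover have "g' (s, j) < N" if "1 \<le> s" "s \<le> r" "1 \<le> j" "j \<le> c" for s j
    proof (cases "s = r")
      case True
      then show ?thesis
        using that outside[of s j] small[of s j] a up by (auto simp: g1_def)
    next
      case False
      with that show ?thesis using inside[of s j] by simp
    qed
    moreover have "g' (s, j) = g (s, j)" if "\<not> (s \<le> r \<and> j \<le> c)" for s j
      using that outside[of s j] up by (auto simp: g1_def)
    moreover have "card {p \<in> rect k l. g1 p = 0} = card {p \<in> rect k l. g p = 0}"
      unfolding g1_def using a by (intro card_zeros_move finite_rect mem mem' hole) auto
    moreover have "word k l (visible N k l g) \<simeq> word k l (visible N k l g1)"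
      using slide_up_word[OF less.prems(1) tab1 g1_def] up rc hole by blast
    ultimately have "slides_to N k l g r c g' (d'(r := c))"
      unfolding slides_to_def slide card using g' rtranclp_trans[OF _ wd] by blast
    then show ?thesis by blast
  next
    case left
    let ?b = "g (r, c - 1)"
    define g1 where "g1 = g((r, c) := ?b, (r, c - 1) := 0)"
    have b: "0 < ?b" "?b < N"
      using left small[of r "c - 1"] rc by auto
    have mem': "(r, c - 1) \<in> rect k l" using left rc by (auto simp: rect_def)
    have g1_simps: "g1 (r, c) = ?b" "g1 (r, c - 1) = 0"
      "p \<noteq> (r, c) \<Longrightarrow> p \<noteq> (r, c - 1) \<Longrightarrow> g1 p = g p" for p
      using left by (auto simp: g1_def)
    have leftof: "leftof (visible N k l g) r c = Some ?b"
      using leftof_visible[OF rc] b left by auto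
    have "(visible N k l g)((r, c) := Some ?b, (r, c - 1) := None) = visible N k l g1"
      using b left mem by (auto simp: visible_def g1_def fun_eq_iff)
    then have slide: "slide (visible N k l g) r c = slide (visible N k l g1) r (c - 1)"
      using leftof left by (subst slide.simps) (auto simp: above)
    have tab1: "tableau_off k l (r, c - 1) g1"
    proof (rule tableau_offI)
      fix s j j' assume s: "1 \<le> s" "s \<le> k" "1 \<le> j" "j < j'" "j' \<le> l"
        "(s, j) \<noteq> (r, c - 1)" "(s, j') \<noteq> (r, c - 1)"
      consider "(s, j) = (r, c)" | "(s, j') = (r, c)" | "(s, j) \<noteq> (r, c)" "(s, j') \<noteq> (r, c)"
        by blast
      then show "g1 (s, j) \<le> g1 (s, j')"
      proof cases
        case 1
        have "?b \<le> g (r, j')"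
          using 1 s left rc by (auto intro!: tab(1))
        with 1 s show ?thesis by (simp add: g1_simps)
      next
        case 2
        then have "j < c - 1" using s by (cases "j = c - 1") auto
        have "g (r, j) \<le> ?b"
          using 2 s \<open>j < c - 1\<close> rc by (auto intro!: tab(1))
        with 2 s show ?thesis by (simp add: g1_simps)
      next
        case 3
        with s show ?thesis using tab(1)[of s j j'] by (simp add: g1_simps)
      qed
    next
      fix s s' j assume s: "1 \<le> s" "s < s'" "s' \<le> k" "1 \<le> j" "j \<le> l"
        "(s, j) \<noteq> (r, c - 1)" "(s', j) \<noteq> (r, c - 1)"
      consider "(s, j) = (r, c)" | "(s', j) = (r, c)" | "(s, j) \<noteq> (r, c)" "(s', j) \<noteq> (r, c)"
        by blast
      then show "g1 (s, j) < g1 (s', j)"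
      proof cases
        case 1
        have "?b < g (s', c - 1)" "g (s', c - 1) \<le> g (s', c)"
          using 1 s left rc by (auto intro!: tab)
        with 1 s show ?thesis by (simp add: g1_simps)
      next
        case 2
        have "g (s, c) \<le> g (r - 1, c)"
          using 2 s rc by (cases "s = r - 1") (auto intro!: less_imp_le[OF tab(2)])
        with 2 s left show ?thesis by (auto simp: g1_simps)
      next
        case 3
        with s show ?thesis using tab(2)[of s s' j] by (simp add: g1_simps)
      qed
    qed
    have lad1: "ladder g1 d r (c - 1)"
    proof -
      have d: "d s < c - 1" if "2 \<le> s" "s \<le> r" for s
      proof -
        have r: "2 \<le> r" using that by simp
        have dr: "d s \<le> d r" "d r < c" "d r = 0 \<or> g (r, d r) \<le> g (r - 1, Suc (d r))"
          using lad that r by (auto simp: ladder_def)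
        \<comment> \<open>Next to the barrier the hole would have moved up.\<close>
        moreover have "d r \<noteq> c - 1"
        proof
          assume "d r = c - 1"
          with dr left have "?b \<le> g (r - 1, c)" by auto
          with left r show False by auto
        qed
        ultimately show ?thesis by simp
      qed
      then have "g1 (s, d s) = g (s, d s)" "g1 (s - 1, Suc (d s)) = g (s - 1, Suc (d s))"
        if "2 \<le> s" "s \<le> r" for s
        using that by (intro g1_simps(3); force)+
      with d lad show ?thesis by (simp add: ladder_def)
    qed
    have "\<exists>g' d'. slides_to N k l g1 r (c - 1) g' d'"
    proof (rule less.hyps[OF _ tab1 _ _ _ _ _ _ _ lad1])
      show "r + (c - 1) < r + c" "1 \<le> r" "r \<le> k" "1 \<le> c - 1" "c - 1 \<le> l" "g1 (r, c - 1) = 0"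
        using left rc g1_simps by auto
      show "g1 (s, j) < N" if "1 \<le> s" "s \<le> r" "1 \<le> j" "j \<le> c - 1" for s j
        using that small[of s j] b by (auto simp: g1_def)
      show "0 < g1 (s, j)" if "2 \<le> s" "s \<le> k" "1 \<le> j" "j \<le> l" "(s, j) \<noteq> (r, c - 1)" for s j
        using that pos[of s j] b by (auto simp: g1_def)
    qed
    then obtain g' d' where g': "slide (visible N k l g1) r (c - 1) = visible N k l g'"
      "tableau_off k l (0, 0) g'"
      and outside: "\<And>s j. \<not> (s \<le> r \<and> j \<le> c - 1) \<Longrightarrow> g' (s, j) = g1 (s, j)"
      and inside: "\<And>s j. 1 \<le> s \<and> s \<le> r \<and> 1 \<le> j \<and> j \<le> c - 1 \<Longrightarrow> g' (s, j) < N"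
      and card: "card {p \<in> rect k l. g' p = 0} = card {p \<in> rect k l. g1 p = 0}"
      and wd: "word k l (visible N k l g1) \<simeq> word k l (visible N k l g')"
      and lad': "\<And>c2. c - 1 < c2 \<and> c2 \<le> l \<Longrightarrow> ladder g' d' r c2"
      unfolding slides_to_def by blast
    have "ladder g' d' r c2" if "c < c2" "c2 \<le> l" for c2
      using that by (intro lad') auto
    moreover have "g' (s, j) < N" if "1 \<le> s" "s \<le> r" "1 \<le> j" "j \<le> c" for s j
    proof (cases "j = c")
      case True
      then show ?thesis
        using that outside[of s j] small[of s j] b left by (auto simp: g1_def)
    next
      case False
      with that show ?thesis using inside[of s j] by simp
    qed
    moreover have "g' (s, j) = g (s, j)" if "\<not> (s \<le> r \<and> j \<le> c)" for s j
    proof -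
      have "\<not> (s \<le> r \<and> j \<le> c - 1)" "(s, j) \<noteq> (r, c)" "(s, j) \<noteq> (r, c - 1)"
        using that left by auto
      then show ?thesis by (metis outside g1_simps(3))
    qed
    moreover have "card {p \<in> rect k l. g1 p = 0} = card {p \<in> rect k l. g p = 0}"
      unfolding g1_def using b by (intro card_zeros_move finite_rect mem mem' hole) auto
    moreover have "word k l (visible N k l g1) = word k l (visible N k l g)"
      unfolding g1_def using left rc hole by (intro slide_left_word) auto
    ultimately have "slides_to N k l g r c g' d'"
      unfolding slides_to_def slide card using g' wd by metis
    then show ?thesis by blast
  next
    case stop
    have "above (visible N k l g) r c = None" "leftof (visible N k l g) r c = None"
      using stop above leftof_visible[OF rc] by auto
    then have "slide (visible N k l g) r c = visible N k l g"
      by (subst slide.simps) simp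
    moreover have "tableau_off k l (0, 0) g"
    proof (rule tableau_offI)
      fix s j j' assume s: "1 \<le> s" "s \<le> k" "1 \<le> j" "j < j'" "j' \<le> l"
      consider "(s, j) = (r, c)" | "(s, j') = (r, c)" | "(s, j) \<noteq> (r, c)" "(s, j') \<noteq> (r, c)"
        by blast
      then show "g (s, j) \<le> g (s, j')"
      proof cases
        case 2
        have "g (r, j) \<le> g (r, c - 1)"
          using 2 s rc by (cases "j = c - 1") (auto intro!: tab(1))
        with 2 s stop show ?thesis by auto
      qed (use hole s tab(1)[of s j j'] in auto)
    next
      fix s s' j assume s: "1 \<le> s" "s < s'" "s' \<le> k" "1 \<le> j" "j \<le> l"
      consider "(s, j) = (r, c)" | "(s', j) = (r, c)" | "(s, j) \<noteq> (r, c)" "(s', j) \<noteq> (r, c)"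
        by blast
      then show "g (s, j) < g (s', j)"
        by cases (use hole stop s pos[of s' j] tab(2)[of s s' j] in auto)
    qed
    moreover have "ladder g d r c2" for c2
      using stop by (auto simp: ladder_def)
    ultimately have "slides_to N k l g r c g d"
      using small by (simp add: slides_to_def)
    then show ?thesis by blast
  qed
qed

section \<open>Promotion\<close>

text \<open>The cells of the strip are filled from left to right, so the barrier of each slide is available to the
  next one. Each slide turns one \<open>N\<close> into a \<open>0\<close>.\<close>

lemma fold_slide_visible:
  assumes "tableau_off k l (0, 0) g" "1 \<le> k" "\<forall>p\<in>rect k l. g p \<le> N" "0 < N"
    and "sorted_wrt (<) cs" "set cs \<subseteq> {1..l}" "{p \<in> rect k l. g p = N} = Pair k ` set cs"
    and "cs \<noteq> [] \<Longrightarrow> ladder g d k (hd cs)"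
  shows "\<exists>g'. fold (\<lambda>(r, c) W. slide W r c) (map (Pair k) cs) (visible N k l g) = visible N k l g' \<and>
    tableau_off k l (0, 0) g' \<and> (\<forall>p\<in>rect k l. g' p < N) \<and>
    card {p \<in> rect k l. g' p = 0} = card {p \<in> rect k l. g p = 0} + length cs \<and>
    word k l (visible N k l g) \<simeq> word k l (visible N k l g')"
  using assms
proof (induction cs arbitrary: g d)
  case Nil
  have "g p < N" if "p \<in> rect k l" for p
  proof -
    have "{p \<in> rect k l. g p = N} = {}" using Nil.prems(7) by simp
    then have "g p \<noteq> N" using that by blast
    then show ?thesis using Nil.prems(3) that by (simp add: nat_less_le)
  qed
  with Nil.prems(1) show ?case by auto
next
  case (Cons c cs)
  note tab = tableau_offD[OF Cons.prems(1)]
  define g0 where "g0 = g((k, c) := 0)"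
  have c: "1 \<le> c" "c \<le> l" and cs: "\<And>c2. c2 \<in> set cs \<Longrightarrow> c < c2 \<and> c2 \<le> l"
    using Cons.prems(5,6) by auto
  have mem: "(k, c) \<in> rect k l" using c Cons.prems(2) by (simp add: rect_def)
  have N: "g p = N \<longleftrightarrow> p \<in> Pair k ` set (c # cs)" if "p \<in> rect k l" for p
    using Cons.prems(7) that by blast
  have gN: "g (k, c) = N" using N[OF mem] by simp
  have vis: "visible N k l g = visible N k l g0"
    using gN by (auto simp: visible_def g0_def fun_eq_iff)
  have "\<exists>g1 d1. slides_to N k l g0 k c g1 d1"
  proof (rule slide_visible[OF _ Cons.prems(2) order.refl c])
    show "tableau_off k l (k, c) g0"
      by (rule tableau_offI) (auto simp: g0_def intro!: tab)
    show "g0 (k, c) = 0" by (simp add: g0_def)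
    show "g0 (s, j) < N" if sj: "1 \<le> s" "s \<le> k" "1 \<le> j" "j \<le> c" for s j
    proof (cases "(s, j) = (k, c)")
      case False
      have m: "(s, j) \<in> rect k l" using sj c by (simp add: rect_def)
      have "(s, j) \<notin> Pair k ` set (c # cs)"
        using False sj cs by fastforce
      then have "g (s, j) \<noteq> N" using N[OF m] by simp
      moreover have "g (s, j) \<le> N" using Cons.prems(3) m by blast
      ultimately have "g (s, j) < N" by simp
      moreover have "g0 (s, j) = g (s, j)" using False by (simp only: g0_def fun_upd_def if_False)
      ultimately show ?thesis by simp
    qed (simp add: g0_def Cons.prems(4))
    show "0 < g0 (s, j)" if "2 \<le> s" "s \<le> k" "1 \<le> j" "j \<le> l" "(s, j) \<noteq> (k, c)" for s j
    proof -
      have "g (1, j) < g (s, j)"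
        using that by (intro tab) auto
      with that show ?thesis by (simp add: g0_def)
    qed
    have lad: "ladder g d k c" using Cons.prems(8) by simp
    have "g0 (s, d s) = g (s, d s)" "g0 (s - 1, Suc (d s)) = g (s - 1, Suc (d s))"
      if "2 \<le> s" "s \<le> k" for s
    proof -
      have "d s < c" "s - 1 < k"
        using lad that by (auto simp: ladder_def)
      then show "g0 (s, d s) = g (s, d s)" "g0 (s - 1, Suc (d s)) = g (s - 1, Suc (d s))"
        by (simp_all add: g0_def)
    qed
    with lad show "ladder g0 d k c"
      by (simp add: ladder_def)
  qed
  then obtain g1 d1 where slide: "slide (visible N k l g0) k c = visible N k l g1"
    and tab1: "tableau_off k l (0, 0) g1"
    and outside: "\<And>s j. \<not> (s \<le> k \<and> j \<le> c) \<Longrightarrow> g1 (s, j) = g0 (s, j)"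
    and inside: "\<And>s j. 1 \<le> s \<and> s \<le> k \<and> 1 \<le> j \<and> j \<le> c \<Longrightarrow> g1 (s, j) < N"
    and card: "card {p \<in> rect k l. g1 p = 0} = card {p \<in> rect k l. g0 p = 0}"
    and wd: "word k l (visible N k l g0) \<simeq> word k l (visible N k l g1)"
    and lad: "\<And>c2. c < c2 \<and> c2 \<le> l \<Longrightarrow> ladder g1 d1 k c2"
    unfolding slides_to_def by blast
  have right: "g1 (s, j) = g (s, j)" if "c < j" for s j
    using that outside[of s j] by (simp add: g0_def)
  have N1: "g1 (s, j) \<le> N \<and> (g1 (s, j) = N \<longleftrightarrow> (s, j) \<in> Pair k ` set cs)"
    if m: "(s, j) \<in> rect k l" for s j
  proof (cases "j \<le> c")
    case True
    then have "g1 (s, j) < N"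
      using m inside[of s j] by (simp add: rect_def)
    moreover have "(s, j) \<notin> Pair k ` set cs" using cs True by fastforce
    ultimately show ?thesis by simp
  next
    case False
    then have "(s, j) \<in> Pair k ` set (c # cs) \<longleftrightarrow> (s, j) \<in> Pair k ` set cs" by auto
    with False m N[OF m] right[of j s] Cons.prems(3) show ?thesis by auto
  qed
  have N1': "g1 p \<le> N \<and> (g1 p = N \<longleftrightarrow> p \<in> Pair k ` set cs)" if "p \<in> rect k l" for p
    using N1[of "fst p" "snd p"] that by simp
  have "\<exists>g'. fold (\<lambda>(r, c) W. slide W r c) (map (Pair k) cs) (visible N k l g1) = visible N k l g' \<and>
    tableau_off k l (0, 0) g' \<and> (\<forall>p\<in>rect k l. g' p < N) \<and>
    card {p \<in> rect k l. g' p = 0} = card {p \<in> rect k l. g1 p = 0} + length cs \<and>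
    word k l (visible N k l g1) \<simeq> word k l (visible N k l g')"
  proof (rule Cons.IH[OF tab1 Cons.prems(2) _ Cons.prems(4)])
    show "\<forall>p\<in>rect k l. g1 p \<le> N" using N1' by blast
    show "sorted_wrt (<) cs" "set cs \<subseteq> {1..l}" using Cons.prems by auto
    have "Pair k ` set cs \<subseteq> rect k l"
      using Cons.prems(2,6) by (auto simp: rect_def)
    then show "{p \<in> rect k l. g1 p = N} = Pair k ` set cs" using N1' by blast
    show "ladder g1 d1 k (hd cs)" if "cs \<noteq> []"
      using lad cs[of "hd cs"] that by simp
  qed
  then obtain g' where g': "fold (\<lambda>(r, c) W. slide W r c) (map (Pair k) cs) (visible N k l g1) = visible N k l g'"
    "tableau_off k l (0, 0) g'" "\<forall>p\<in>rect k l. g' p < N"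
    "card {p \<in> rect k l. g' p = 0} = card {p \<in> rect k l. g1 p = 0} + length cs"
    "word k l (visible N k l g1) \<simeq> word k l (visible N k l g')"
    by blast
  have "{p \<in> rect k l. g0 p = 0} = insert (k, c) {p \<in> rect k l. g p = 0}"
    using mem by (auto simp: g0_def)
  then have "card {p \<in> rect k l. g0 p = 0} = Suc (card {p \<in> rect k l. g p = 0})"
    using gN Cons.prems(4) by (simp add: finite_rect)
  then show ?case
    using g' slide vis card rtranclp_trans[OF wd g'(5)] by (intro exI[of _ g']) simp
qed

text \<open>Below a letter \<open>n\<close> there is no room for a larger one, so in a rectangle the strip lies in the bottom
  row.\<close>

lemma strip_CST:
  assumes T: "T \<in> CST n k l" and k: "1 \<le> k"
  defines "cs \<equiv> filter (\<lambda>c. T (k, c) = Some n) [1..<Suc l]"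
  shows "strip n k l T = map (Pair k) cs"
    and "{p. T p = Some n} = Pair k ` set cs"
proof -
  have bottom: "r = k" if "T (r, c) = Some n" for r c
  proof (rule ccontr)
    assume "r \<noteq> k"
    moreover have m: "(r, c) \<in> rect k l" using that T by (auto simp: CST_def)
    ultimately have "(k, c) \<in> rect k l" "r < k" by (auto simp: rect_def)
    then have "the (T (r, c)) < the (T (k, c))" "the (T (k, c)) \<le> n"
      using CST_column[OF T m] CST_entry_bounds[OF T] by auto
    with that show False by simp
  qed
  have "[(r, c). r \<leftarrow> [1..<Suc k], T (r, c) = Some n] = (if T (k, c) = Some n then [(k, c)] else [])" for c
  proof -
    have "concat (map (\<lambda>r. if T (r, c) = Some n then [(r, c)] else []) [1..<k]) = []"
      using bottom[of _ c] by auto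
    with k show ?thesis by simp
  qed
  moreover have "concat (map (\<lambda>c. if T (k, c) = Some n then [(k, c)] else []) js) =
      map (Pair k) (filter (\<lambda>c. T (k, c) = Some n) js)" for js
    by (induction js) auto
  ultimately show "strip n k l T = map (Pair k) cs"
    unfolding strip_def cs_def by (simp del: upt_Suc)
  show "{p. T p = Some n} = Pair k ` set cs"
  proof (intro equalityI subsetI)
    fix p assume "p \<in> {p. T p = Some n}"
    moreover obtain r c where "p = (r, c)" by force
    moreover have "p \<in> rect k l" using calculation T by (auto simp: CST_def)
    ultimately show "p \<in> Pair k ` set cs"
      using bottom by (auto simp: cs_def rect_def simp del: upt_Suc)
  qed (auto simp: cs_def simp del: upt_Suc)
qed

text \<open>The marks \<open>0\<close> of the last state become the ones of \<open>pr T\<close>, and all other letters are shifted by one.\<close>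

lemma promotion_CST:
  assumes T: "T \<in> CST n k l" and k: "1 \<le> k" and n: "1 \<le> n"
  shows "pr n k l T \<in> CST n k l"
    and "mult 1 (pr n k l T) = mult n T"
    and "map Suc (filter (\<lambda>a. a < n) (word k l T)) \<simeq> filter (\<lambda>a. 1 < a) (word k l (pr n k l T))"
proof -
  define cs where "cs = filter (\<lambda>c. T (k, c) = Some n) [1..<Suc l]"
  note strip = strip_CST[OF T k, folded cs_def]
  define g where "g = (\<lambda>p. the (T p))"
  have T_eq: "T p = (if p \<in> rect k l then Some (g p) else None)" for p
    using CST_entry[OF T, of p] T by (auto simp: g_def CST_def)
  have bounds: "1 \<le> g p" "g p \<le> n" if "p \<in> rect k l" for p
    using CST_entry_bounds[OF T that] by (auto simp: g_def)
  have remove: "remove_letter n T = visible n k l g"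
  proof
    fix p
    show "remove_letter n T p = visible n k l g p"
      using bounds[of p] by (auto simp: remove_letter_def visible_def T_eq)
  qed
  have tab: "tableau_off k l (0, 0) g"
    unfolding g_def
    by (rule tableau_offI) (auto intro!: CST_row[OF T] CST_column[OF T] simp: rect_def)
  have "\<exists>g'. fold (\<lambda>(r, c) W. slide W r c) (map (Pair k) cs) (visible n k l g) = visible n k l g' \<and>
    tableau_off k l (0, 0) g' \<and> (\<forall>p\<in>rect k l. g' p < n) \<and>
    card {p \<in> rect k l. g' p = 0} = card {p \<in> rect k l. g p = 0} + length cs \<and>
    word k l (visible n k l g) \<simeq> word k l (visible n k l g')"
  \<comment> \<open>Nothing has been vacated yet, so the left border serves as the first barrier.\<close>
  proof (rule fold_slide_visible[where d = "\<lambda>_. 0", OF tab k])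
    show "\<forall>p\<in>rect k l. g p \<le> n" "0 < n" using bounds n by auto
    show "sorted_wrt (<) cs"
      unfolding cs_def by (intro sorted_wrt_filter) (simp add: sorted_wrt_upt del: upt_Suc)
    show sub: "set cs \<subseteq> {1..l}" by (auto simp: cs_def)
    show "{p \<in> rect k l. g p = n} = Pair k ` set cs"
      using strip(2) T_eq by (auto split: if_splits)
    show "ladder g (\<lambda>_. 0) k (hd cs)" if "cs \<noteq> []"
    proof -
      have "hd cs \<in> {1..l}" using sub that hd_in_set by blast
      moreover have "0 < g (s - 1, 1)" if "2 \<le> s" "s \<le> k" for s
      proof -
        have "(s - 1, 1) \<in> rect k l"
          using that \<open>hd cs \<in> {1..l}\<close> by (auto simp: rect_def)
        then show ?thesis using bounds(1) by fastforce
      qed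
      ultimately show ?thesis by (simp add: ladder_def)
    qed
  qed
  then obtain g' where fold: "fold (\<lambda>(r, c) W. slide W r c) (map (Pair k) cs) (visible n k l g) = visible n k l g'"
    and tab': "tableau_off k l (0, 0) g'" and less: "\<forall>p\<in>rect k l. g' p < n"
    and zeros: "card {p \<in> rect k l. g' p = 0} = card {p \<in> rect k l. g p = 0} + length cs"
    and wd: "word k l (visible n k l g) \<simeq> word k l (visible n k l g')"
    by blast
  have "pr n k l T = (\<lambda>p. if p \<in> rect k l
      then Some (Suc (case visible n k l g' p of None \<Rightarrow> 0 | Some a \<Rightarrow> a)) else None)"
    by (simp only: pr_def Let_def strip(1) remove fold)
  then have pr: "pr n k l T = (\<lambda>p. if p \<in> rect k l then Some (Suc (g' p)) else None)"
    using less by (auto simp: visible_def fun_eq_iff)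
  note tab' = tableau_offD[OF tab']
  show CST: "pr n k l T \<in> CST n k l"
    unfolding CST_def
  proof (intro CollectI conjI allI impI)
    show "dom (pr n k l T) = rect k l" by (auto simp: pr split: if_splits)
    show "ran (pr n k l T) \<subseteq> {1..n}"
      using less by (auto simp: pr ran_def Suc_le_eq split: if_splits)
  next
    fix r c assume "(r, c) \<in> rect k l \<and> (r, Suc c) \<in> rect k l"
    then show "the (pr n k l T (r, c)) \<le> the (pr n k l T (r, Suc c))"
      using tab'(1)[of r c "Suc c"] by (simp add: pr rect_def)
  next
    fix r c assume "(r, c) \<in> rect k l \<and> (Suc r, c) \<in> rect k l"
    then show "the (pr n k l T (r, c)) < the (pr n k l T (Suc r, c))"
      using tab'(2)[of r "Suc r" c] by (simp add: pr rect_def)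
  qed
  have "{p. pr n k l T p = Some 1} = {p \<in> rect k l. g' p = 0}"
    by (auto simp: pr split: if_splits)
  moreover have "card {p \<in> rect k l. g p = 0} = 0"
  proof -
    have "{p \<in> rect k l. g p = 0} = {}" using bounds by fastforce
    then show ?thesis by (simp only: card.empty)
  qed
  moreover have "card (Pair k ` set cs) = length cs"
  proof -
    have "distinct cs" by (simp add: cs_def del: upt_Suc)
    then show ?thesis by (simp add: card_image inj_on_def distinct_card)
  qed
  ultimately show "mult 1 (pr n k l T) = mult n T"
    using zeros by (simp add: mult_def strip(2))
  have "word k l T = map g (reading k l)"
    by (simp add: CST_word[OF T] g_def)
  moreover have "filter (\<lambda>a. a < n) (map g (reading k l)) = filter (\<lambda>a. 0 < a \<and> a < n) (map g (reading k l))"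
    using bounds by (intro filter_cong) (auto simp: set_reading Suc_le_eq)
  ultimately have w1: "filter (\<lambda>a. a < n) (word k l T) = word k l (visible n k l g)"
    by (simp only: word_visible)
  have "word k l (pr n k l T) = map Suc (map g' (reading k l))"
    unfolding CST_word[OF CST] by (simp add: pr set_reading)
  then have "filter (\<lambda>a. 1 < a) (word k l (pr n k l T)) = map Suc (filter (\<lambda>a. 0 < a) (map g' (reading k l)))"
    by (simp add: filter_map comp_def)
  moreover have "filter (\<lambda>a. 0 < a) (map g' (reading k l)) = filter (\<lambda>a. 0 < a \<and> a < n) (map g' (reading k l))"
    using less by (intro filter_cong) (auto simp: set_reading)
  ultimately have w2: "filter (\<lambda>a. 1 < a) (word k l (pr n k l T)) = map Suc (word k l (visible n k l g'))"
    by (simp only: word_visible)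
  show "map Suc (filter (\<lambda>a. a < n) (word k l T)) \<simeq> filter (\<lambda>a. 1 < a) (word k l (pr n k l T))"
    unfolding w1 w2 using wd by (rule knuth_map_Suc)
qed

section \<open>Level zero\<close>

lemma iterate_op_closed_map:
  assumes "\<And>b. b \<in> X \<Longrightarrow> set_option (g b) \<subseteq> X"
    and "\<And>b. b \<in> X \<Longrightarrow> map_option \<psi> (g b) = h (\<psi> b)" "b \<in> X"
  shows "iterate_op h m (\<psi> b) = map_option \<psi> (iterate_op g m b) \<and> set_option (iterate_op g m b) \<subseteq> X"
proof (induction m)
  case (Suc m)
  then show ?case
    using assms by (cases "iterate_op g m b") auto
qed (use assms in simp)

lemma string_length_map:
  assumes "\<And>b. b \<in> X \<Longrightarrow> set_option (g b) \<subseteq> X"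
    and "\<And>b. b \<in> X \<Longrightarrow> map_option \<psi> (g b) = h (\<psi> b)" "b \<in> X"
  shows "string_length h (\<psi> b) = string_length g b"
  using iterate_op_closed_map[of X g \<psi> h, OF assms] by (simp add: string_length_def)

lemma iterate_op_Suc_front: "iterate_op g (Suc m) b = Option.bind (g b) (iterate_op g m)"
proof (induction m)
  case (Suc m)
  then show ?case by (cases "g b") auto
qed (cases "g b"; simp)

lemma iterate_op_inverse:
  assumes "\<And>b. b \<in> X \<Longrightarrow> set_option (f b) \<subseteq> X"
    and "\<And>b b'. b \<in> X \<Longrightarrow> b' \<in> X \<Longrightarrow> f b = Some b' \<Longrightarrow> e b' = Some b"
    and "b \<in> X" "iterate_op f m b = Some b'"
  shows "b' \<in> X \<and> iterate_op e m b' = Some b"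
  using assms(4)
proof (induction m arbitrary: b')
  case 0
  then show ?case using assms(3) by simp
next
  case (Suc m)
  then obtain a where a: "iterate_op f m b = Some a" "f a = Some b'"
    by (auto simp: bind_eq_Some_conv)
  with Suc.IH have "a \<in> X" "iterate_op e m a = Some b" by auto
  moreover have "b' \<in> X" using assms(1)[OF \<open>a \<in> X\<close>] a by auto
  ultimately show ?case
    using assms(2)[OF \<open>a \<in> X\<close> \<open>b' \<in> X\<close> a(2)] unfolding iterate_op_Suc_front by simp
qed

lemma string_length_card:
  assumes "finite {m. iterate_op g m b \<noteq> None}"
  shows "string_length g b = card {m. iterate_op g (Suc m) b \<noteq> None}"
proof -
  define S where "S = {m. iterate_op g m b \<noteq> None}"
  have down: "m \<in> S \<Longrightarrow> m' \<le> m \<Longrightarrow> m' \<in> S" for m m'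
  proof (induction m)
    case (Suc m)
    then have "m \<in> S" by (cases "iterate_op g m b") (auto simp: S_def)
    with Suc show ?case by (cases "m' = Suc m") auto
  qed simp
  have ne: "S \<noteq> {}" by (auto simp: S_def intro: exI[of _ 0])
  have "Suc m \<in> S \<longleftrightarrow> m < Max S" for m
    using down[OF Max_in[OF _ ne], of "Suc m"] Max_ge[of S "Suc m"] assms
    by (auto simp: S_def Suc_le_eq)
  then have "{m. Suc m \<in> S} = {..<Max S}" by auto
  then have "card {m. Suc m \<in> S} = Max S" by simp
  then show ?thesis by (simp add: string_length_def S_def)
qed

text \<open>Both sides count the pairs of vertices on a common string, the first one strictly before the second.\<close>

lemma sum_string_lengths_eq:
  assumes X: "finite X"
    and f: "\<And>b. b \<in> X \<Longrightarrow> set_option (f b) \<subseteq> X" and e: "\<And>b. b \<in> X \<Longrightarrow> set_option (e b) \<subseteq> X"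
    and inv: "\<And>b b'. b \<in> X \<Longrightarrow> b' \<in> X \<Longrightarrow> f b = Some b' \<longleftrightarrow> e b' = Some b"
    and fin: "\<And>b. b \<in> X \<Longrightarrow> finite {m. iterate_op f m b \<noteq> None}"
      "\<And>b. b \<in> X \<Longrightarrow> finite {m. iterate_op e m b \<noteq> None}"
  shows "(\<Sum>b\<in>X. string_length f b) = (\<Sum>b\<in>X. string_length e b)"
proof -
  have fin': "finite {m. iterate_op g (Suc m) b \<noteq> None}"
    if "finite {m. iterate_op g m b \<noteq> None}" for g :: "'a \<Rightarrow> 'a option" and b
    using finite_vimageI[OF that, of Suc] by (simp add: vimage_def)
  have fe: "b' \<in> X \<and> iterate_op e m b' = Some b" if "b \<in> X" "iterate_op f m b = Some b'" for b b' m
    using iterate_op_inverse[of X f e b m b'] f inv that by blast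
  have ef: "b' \<in> X \<and> iterate_op f m b' = Some b" if "b \<in> X" "iterate_op e m b = Some b'" for b b' m
    using iterate_op_inverse[of X e f b m b'] e inv that by blast
  have "(\<Sum>b\<in>X. string_length f b) = card (SIGMA b:X. {m. iterate_op f (Suc m) b \<noteq> None})"
    using X fin' fin(1) by (subst card_SigmaI) (auto simp: string_length_card[OF fin(1)])
  also have "\<dots> = card (SIGMA b:X. {m. iterate_op e (Suc m) b \<noteq> None})"
  proof (rule bij_betw_same_card)
    show "bij_betw (\<lambda>(b, m). (the (iterate_op f (Suc m) b), m))
        (SIGMA b:X. {m. iterate_op f (Suc m) b \<noteq> None})
        (SIGMA b:X. {m. iterate_op e (Suc m) b \<noteq> None})"
      by (rule bij_betw_byWitness[where f' = "\<lambda>(b, m). (the (iterate_op e (Suc m) b), m)"])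
        (auto dest: fe ef simp del: iterate_op.simps)
  qed
  also have "\<dots> = (\<Sum>b\<in>X. string_length e b)"
    using X fin' fin(2) by (subst card_SigmaI) (auto simp: string_length_card[OF fin(2)])
  finally show ?thesis .
qed

text \<open>The null vector of the affine Cartan matrix: the canonical central element vanishes on the roots.\<close>

lemma sum_simple_root:
  assumes "j < n"
  shows "(\<Sum>i<n. simple_root n j i) = 0"
proof -
  obtain m where n: "n = Suc m" using assms by (cases n) auto
  have "(\<Sum>i<n. of_bool (i = x)) = (1 :: int)" if "x < n" for x
    using that by (simp add: of_bool_def sum.delta)
  moreover have "(\<Sum>i<n. of_bool (j = Suc i mod n)) = (1 :: int)"
  proof -
    have "(\<Sum>i<m. of_bool (j = Suc i mod n)) = (\<Sum>i<m. of_bool (j = Suc i) :: int)"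
      by (intro sum.cong) (auto simp: n)
    also have "\<dots> = of_bool (1 \<le> j \<and> j \<le> m)"
      by (induction m) (auto simp: of_bool_def)
    finally show ?thesis
      using assms by (auto simp: n)
  qed
  ultimately show ?thesis
    using assms by (simp add: simple_root_def cartan_def sum_subtractf sum_distrib_left[symmetric])
qed

text \<open>The level does not change along edges, hence it is constant. Its sum over all vertices vanishes,
  because each \<open>\<langle>h\<^sub>i, wt b\<rangle>\<close> is the difference of the distances of \<open>b\<close> to the two ends of its string.\<close>

lemma level_zero:
  assumes C: "affine_crystal n C" and conn: "crystal_connected n C" and X: "finite (verts C)"
    and b: "b \<in> verts C"
  shows "(\<Sum>i<n. cr_wt C b i) = 0"
proof -
  define lev where "lev = (\<lambda>b. \<Sum>i<n. cr_wt C b i)"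
  have step: "lev b' = lev b" if "b \<in> verts C" "i < n" "cr_f C i b = Some b'" for b b' i
  proof -
    have "cr_wt C b' = (\<lambda>j. cr_wt C b j - simple_root n i j)"
      using C that by (simp add: affine_crystal_def)
    then show ?thesis
      using sum_simple_root[OF \<open>i < n\<close>] by (simp add: lev_def sum_subtractf)
  qed
  have const: "lev b' = lev b" if b': "b' \<in> verts C" for b'
  proof -
    define E where "E = {(b, b'). b \<in> verts C \<and> (\<exists>i<n. cr_f C i b = Some b')}"
    have "(b, b') \<in> (E \<union> E\<inverse>)\<^sup>*"
      using conn b b' unfolding crystal_connected_def E_def Let_def by blast
    then show ?thesis
      by (induction rule: rtrancl_induct) (auto simp: E_def dest: step)
  qed
  have "(\<Sum>b\<in>verts C. cr_wt C b i) = 0" if i: "i < n" for i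
  proof -
    have props: "set_option (cr_e C i b) \<subseteq> verts C" "set_option (cr_f C i b) \<subseteq> verts C"
      "\<And>b'. b' \<in> verts C \<Longrightarrow> cr_f C i b = Some b' \<longleftrightarrow> cr_e C i b' = Some b"
      "finite {m. iterate_op (cr_e C i) m b \<noteq> None}" "finite {m. iterate_op (cr_f C i) m b \<noteq> None}"
      "cr_wt C b i = int (cr_phi C i b) - int (cr_eps C i b)"
      if "b \<in> verts C" for b
      using C i that unfolding affine_crystal_def by blast+
    have "(\<Sum>b\<in>verts C. cr_phi C i b) = (\<Sum>b\<in>verts C. cr_eps C i b)"
      using props X by (intro sum_string_lengths_eq) blast+
    then have "(\<Sum>b\<in>verts C. int (cr_phi C i b)) = (\<Sum>b\<in>verts C. int (cr_eps C i b))"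
      by (simp flip: of_nat_sum)
    then show ?thesis by (simp add: props(6) sum_subtractf)
  qed
  then have "(\<Sum>b\<in>verts C. lev b) = 0"
    unfolding lev_def by (subst sum.swap) simp
  moreover have "(\<Sum>b\<in>verts C. lev b) = int (card (verts C)) * lev b"
    using const by simp
  ultimately show ?thesis
    using X b by (auto simp: lev_def)
qed

section \<open>The rotation of the Dynkin diagram\<close>

lemma sum_mult_CST:
  assumes T: "T \<in> CST n k l"
  shows "(\<Sum>a = 1..n. mult a T) = k * l"
proof -
  have "set (word k l T) \<subseteq> {1..n}"
    using CST_entry_bounds[OF T] by (auto simp: CST_word[OF T] set_reading)
  then have "(\<Sum>a = 1..n. count_list (word k l T) a) = length (word k l T)"
    by (intro sum_count_set) auto
  moreover have "length (word k l T) = k * l"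
    by (simp add: CST_word[OF T] distinct_card[OF distinct_reading, symmetric] set_reading rect_def)
  moreover have "dom T \<subseteq> rect k l" using T by (simp add: CST_def)
  ultimately show ?thesis by (simp add: mult_eq_count)
qed

lemma mult_cst_e:
  assumes T: "T \<in> CST n k l" "T' \<in> CST n k l" and "cst_e k l i T = Some T'" "a \<noteq> i" "a \<noteq> Suc i"
  shows "mult a T' = mult a T"
proof -
  have "word_e i (word k l T) 0 = Some (word k l T')"
    using cst_e_word[of k l i T] assms(3) by simp
  then have "filter ((=) a) (word k l T') = filter ((=) a) (word k l T)"
    using assms by (intro word_e_filter_out) auto
  moreover have "dom T \<subseteq> rect k l" "dom T' \<subseteq> rect k l" using T by (simp_all add: CST_def)
  ultimately show ?thesis by (simp add: mult_eq_count count_list_eq_length_filter)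
qed

text \<open>Lowering operators determine raising operators. Surjectivity of \<open>\<psi>\<close> is needed to exclude that
  \<open>\<psi> b\<close> can be raised while \<open>b\<close> cannot.\<close>

lemma diagram_rotation_raising:
  assumes C: "affine_crystal n C" and bij: "bij_betw \<psi> (verts C) (verts C)" and j: "j < n"
    and i: "i < n"
    and comm: "\<And>b. b \<in> verts C \<Longrightarrow> map_option \<psi> (cr_f C i b) = cr_f C j (\<psi> b)"
    and b: "b \<in> verts C"
  shows "map_option \<psi> (cr_e C i b) = cr_e C j (\<psi> b)"
proof -
  have crystal: "set_option (cr_e C i b) \<subseteq> verts C \<and> set_option (cr_f C i b) \<subseteq> verts C \<and>
      (\<forall>b'\<in>verts C. cr_f C i b = Some b' \<longleftrightarrow> cr_e C i b' = Some b)"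
    if "i < n" "b \<in> verts C" for i b
    using C that unfolding affine_crystal_def by blast
  have closed: "b' \<in> verts C" if "i < n" "b \<in> verts C" "cr_e C i b = Some b' \<or> cr_f C i b = Some b'"
    for i b b'
    using crystal[OF that(1,2)] that(3) by auto
  have inv: "cr_f C i b = Some b' \<longleftrightarrow> cr_e C i b' = Some b"
    if "i < n" "b \<in> verts C" "b' \<in> verts C" for i b b'
    using crystal[OF that(1,2)] that(3) by blast
  have \<psi>: "\<psi> b \<in> verts C" if "b \<in> verts C" for b
    using bij that by (auto simp: bij_betw_def)
  show ?thesis
  proof (cases "cr_e C i b")
    case (Some b')
    then have "b' \<in> verts C" "cr_f C i b' = Some b"
      using closed[OF i b] inv[OF i _ b] by blast+
    then have "cr_f C j (\<psi> b') = Some (\<psi> b)"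
      using comm[of b'] by simp
    then show ?thesis
      using inv[OF j \<psi> \<psi>] \<open>b' \<in> verts C\<close> b Some by simp
  next
    case None
    have "cr_e C j (\<psi> b) = None"
    proof (rule ccontr)
      assume "cr_e C j (\<psi> b) \<noteq> None"
      then obtain y where y: "cr_e C j (\<psi> b) = Some y" by blast
      then have "y \<in> verts C" using closed[OF j \<psi>[OF b]] by blast
      then obtain b' where b': "b' \<in> verts C" "y = \<psi> b'"
        using bij by (auto simp: bij_betw_def)
      then have "map_option \<psi> (cr_f C i b') = Some (\<psi> b)"
        using y inv[OF j \<psi> \<psi>] b comm by simp
      then obtain b'' where b'': "cr_f C i b' = Some b''" "\<psi> b'' = \<psi> b" by auto
      then have "b'' \<in> verts C" using closed[OF i b'(1)] by blast
      then have "b'' = b" using b''(2) b bij by (auto simp: bij_betw_def inj_on_def)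
      then show False using b'' None inv[OF i b'(1) b] by simp
    qed
    with None show ?thesis by simp
  qed
qed

lemma diagram_rotation_weight:
  assumes C: "affine_crystal n C" and bij: "bij_betw \<psi> (verts C) (verts C)" and j: "j < n"
    and i: "i < n"
    and comm: "\<And>b. b \<in> verts C \<Longrightarrow> map_option \<psi> (cr_f C i b) = cr_f C j (\<psi> b)"
    and b: "b \<in> verts C"
  shows "cr_wt C (\<psi> b) j = cr_wt C b i"
proof -
  have "set_option (cr_e C i b) \<subseteq> verts C" "set_option (cr_f C i b) \<subseteq> verts C" if "b \<in> verts C" for b
    using C i that unfolding affine_crystal_def by blast+
  then have "cr_phi C j (\<psi> b) = cr_phi C i b" "cr_eps C j (\<psi> b) = cr_eps C i b"
    using comm diagram_rotation_raising[OF C bij j i comm] b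
    by (auto intro!: string_length_map[where X = "verts C"])
  moreover have "\<psi> b \<in> verts C" using bij b by (auto simp: bij_betw_def)
  ultimately show ?thesis
    using C i j b by (simp add: affine_crystal_def)
qed

text \<open>The classical weights give the differences of successive multiplicities, and the weight at \<open>0\<close> is
  supplied by level zero. Hence the content of \<open>\<psi> b\<close> is the rotated content of \<open>b\<close> up to a constant, which
  is zero since both tableaux have the same number of cells.\<close>

lemma mult_one_rotated:
  assumes n: "2 \<le> n"
    and C: "affine_crystal n C" and conn: "crystal_connected n C" and fin: "finite (verts C)"
    and CST: "restricts_to_CST n k l C"
    and bij: "bij_betw \<psi> (verts C) (verts C)"
    and comm: "\<And>i b. i < n \<Longrightarrow> b \<in> verts C \<Longrightarrow>
      map_option \<psi> (cr_f C i b) = cr_f C (Suc i mod n) (\<psi> b)"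
    and b: "b \<in> verts C"
  shows "mult 1 (\<psi> b) = mult n b"
proof -
  have \<psi>b: "\<psi> b \<in> verts C" using bij b by (auto simp: bij_betw_def)
  define x y where "x = (\<lambda>a. int (mult a b))" and "y = (\<lambda>a. int (mult a (\<psi> b)))"
  have wt: "cr_wt C c i = int (mult i c) - int (mult (Suc i) c)"
    if "1 \<le> i" "i < n" "c \<in> verts C" for i c
    using CST that by (auto simp: restricts_to_CST_def)
  have rot: "cr_wt C (\<psi> b) (Suc i mod n) = cr_wt C b i" if "i < n" for i
    using diagram_rotation_weight[OF C bij _ that comm[OF that] b] n by simp
  have "(\<Sum>i = 1..<m. cr_wt C b i) = x 1 - x m" if "1 \<le> m" "m \<le> n" for m
    using that
  proof (induction m rule: dec_induct)
    case (step m)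
    then show ?case using wt[of m b] b by (simp add: x_def)
  qed simp
  then have "(\<Sum>i = 1..<n. cr_wt C b i) = x 1 - x n" using n by simp
  moreover have "(\<Sum>i<n. cr_wt C b i) = cr_wt C b 0 + (\<Sum>i = 1..<n. cr_wt C b i)"
    using n by (simp add: lessThan_atLeast0 sum.atLeast_Suc_lessThan)
  ultimately have "cr_wt C b 0 = x n - x 1"
    using level_zero[OF C conn fin b] by simp
  then have first: "y 1 - y 2 = x n - x 1"
    using rot[of 0] wt[of 1 "\<psi> b"] n \<psi>b by (simp add: y_def numeral_2_eq_2)
  have next_diff: "y (Suc i) - y (Suc (Suc i)) = x i - x (Suc i)" if "1 \<le> i" "Suc i < n" for i
    using rot[of i] wt[of i b] wt[of "Suc i" "\<psi> b"] that b \<psi>b by (simp add: x_def y_def)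
  define \<delta> where "\<delta> = y 1 - x n"
  have shift: "y (Suc i) = x i + \<delta>" if "1 \<le> i" "i < n" for i
    using that
  proof (induction i rule: dec_induct)
    case base
    then show ?case using first by (simp add: numeral_2_eq_2 \<delta>_def)
  next
    case (step i)
    then show ?case using next_diff[of i] by simp
  qed
  have total: "(\<Sum>a = 1..n. mult a c) = k * l" if "c \<in> verts C" for c
    using sum_mult_CST[of c n k l] that CST by (simp add: restricts_to_CST_def)
  have totals: "(\<Sum>a = 1..n. y a) = (\<Sum>a = 1..n. x a)"
    unfolding x_def y_def of_nat_sum[symmetric] total[OF b] total[OF \<psi>b] ..
  have split: "(\<Sum>a = 1..m. y a) = y 1 + (\<Sum>i = 1..<m. y (Suc i)) \<and>
      (\<Sum>a = 1..m. x a) = (\<Sum>i = 1..<m. x i) + x m" if "1 \<le> m" for m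
    using that by (induction m rule: dec_induct) (auto simp: sum.atLeastLessThan_Suc)
  have "(\<Sum>i = 1..<n. y (Suc i)) = (\<Sum>i = 1..<n. x i) + int (n - 1) * \<delta>"
    using shift by (simp add: sum.distrib)
  then have "\<delta> + int (n - 1) * \<delta> = 0"
    using totals split[of n] n unfolding \<delta>_def by linarith
  then have "(1 + int (n - 1)) * \<delta> = 0"
    by (simp only: distrib_right mult_1)
  then have "\<delta> = 0"
    unfolding mult_eq_0_iff by linarith
  then show ?thesis by (simp add: \<delta>_def x_def y_def)
qed

text \<open>Induction on the sum of the entries of \<open>b\<close>: as long as \<open>b\<close> can be raised with a colour \<open>i < n - 1\<close>, so can
  \<open>T\<close> with the colour \<open>i + 1\<close>, and the hypotheses survive. If \<open>b\<close> cannot be raised, then \<open>T\<close> and \<open>\<psi> b\<close> are both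
  of highest weight for the colours \<open>2, \<dots>, n - 1\<close> and have the same number of ones.\<close>

lemma raising_determines_rotation:
  assumes n: "2 \<le> n" and k: "1 \<le> k" and l: "1 \<le> l"
    and C: "affine_crystal n C" and conn: "crystal_connected n C" and fin: "finite (verts C)"
    and CST: "restricts_to_CST n k l C"
    and bij: "bij_betw \<psi> (verts C) (verts C)"
    and comm: "\<And>i b. i < n \<Longrightarrow> b \<in> verts C \<Longrightarrow>
      map_option \<psi> (cr_f C i b) = cr_f C (Suc i mod n) (\<psi> b)"
    and "b \<in> CST n k l" "T \<in> CST n k l" "mult 1 T = mult n b"
    and "map Suc (filter (\<lambda>a. a < n) (word k l b)) \<simeq> filter (\<lambda>a. 1 < a) (word k l T)"
  shows "T = \<psi> b"
  using assms(10-)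
proof (induction "sum_list (word k l b)" arbitrary: b T rule: less_induct)
  case less
  note b = less.prems(1) and T = less.prems(2) and mult = less.prems(3) and knuth = less.prems(4)
  have verts: "verts C = CST n k l"
    and classical: "\<And>i b. 1 \<le> i \<Longrightarrow> i < n \<Longrightarrow> b \<in> CST n k l \<Longrightarrow> cr_e C i b = cst_e k l i b"
    using CST by (auto simp: restricts_to_CST_def)
  have e_closed: "b' \<in> CST n k l" and f_inv: "cr_f C i b' = Some b"
    if "1 \<le> i" "i < n" "b \<in> CST n k l" "cst_e k l i b = Some b'" for i b b'
  proof -
    have e: "cr_e C i b = Some b'" using classical that by simp
    have "set_option (cr_e C i b) \<subseteq> verts C"
      using C that unfolding affine_crystal_def verts by blast
    then show "b' \<in> CST n k l" using e verts by simp
    then show "cr_f C i b' = Some b"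
      using C that e unfolding affine_crystal_def verts by blast
  qed
  have rel: "rel_option knuth
      (map_option (\<lambda>b'. map Suc (filter (\<lambda>a. a < n) (word k l b'))) (cst_e k l i b))
      (map_option (\<lambda>T'. filter (\<lambda>a. 1 < a) (word k l T')) (cst_e k l (Suc i) T))"
    if i: "1 \<le> i" "Suc i < n" for i
  proof -
    have "word_e (Suc i) (map Suc (filter (\<lambda>a. a < n) (word k l b))) 0 =
        map_option (\<lambda>b'. map Suc (filter (\<lambda>a. a < n) (word k l b'))) (cst_e k l i b)"
      using i by (simp add: word_e_map_Suc word_e_filter option.map_comp comp_def flip: cst_e_word)
    moreover have "word_e (Suc i) (filter (\<lambda>a. 1 < a) (word k l T)) 0 =
        map_option (\<lambda>T'. filter (\<lambda>a. 1 < a) (word k l T')) (cst_e k l (Suc i) T)"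
      using i by (simp add: word_e_filter option.map_comp comp_def flip: cst_e_word)
    ultimately show ?thesis
      using knuth_word_e[OF knuth, of "Suc i" 0] by simp
  qed
  show ?case
  proof (cases "\<exists>i b'. 1 \<le> i \<and> Suc i < n \<and> cst_e k l i b = Some b'")
    case True
    then obtain i b' where i: "1 \<le> i" "Suc i < n" and b': "cst_e k l i b = Some b'" by blast
    with rel[OF i] obtain T' where T': "cst_e k l (Suc i) T = Some T'"
      "map Suc (filter (\<lambda>a. a < n) (word k l b')) \<simeq> filter (\<lambda>a. 1 < a) (word k l T')"
      by (auto simp: option_rel_Some1)
    have CST': "b' \<in> CST n k l" "T' \<in> CST n k l"
      using e_closed[OF _ _ b b'] e_closed[OF _ _ T T'(1)] i by auto
    have "word_e i (word k l b) 0 = Some (word k l b')"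
      using cst_e_word[of k l i b] b' by simp
    moreover have "mult n b' = mult n b" "mult 1 T' = mult 1 T"
      using mult_cst_e[OF b CST'(1) b'] mult_cst_e[OF T CST'(2) T'(1)] i by auto
    ultimately have "T' = \<psi> b'"
      using less.hyps[OF word_e_sum_list CST'] T'(2) mult by simp
    moreover have "cr_f C i b' = Some b" "cr_f C (Suc i) T' = Some T"
      using f_inv[OF _ _ b b'] f_inv[OF _ _ T T'(1)] i by auto
    ultimately show ?thesis
      using comm[of i b'] i CST' verts by simp
  next
    case False
    then have none: "cst_e k l i b = None" if "1 \<le> i" "Suc i < n" for i
      using that by (cases "cst_e k l i b") auto
    have \<psi>b: "\<psi> b \<in> CST n k l"
      using bij b verts by (auto simp: bij_betw_def)
    have highest: "word_e i (word k l T) 0 = None" "word_e i (word k l (\<psi> b)) 0 = None"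
      if "2 \<le> i" "i < n" for i
    proof -
      obtain j where j: "i = Suc j" "1 \<le> j" "Suc j < n"
        using \<open>2 \<le> i\<close> \<open>i < n\<close> by (cases i) auto
      show "word_e i (word k l T) 0 = None"
        using rel[OF j(2,3)] none[OF j(2,3)] by (simp add: j(1) flip: cst_e_word)
      have "map_option \<psi> (cr_e C j b) = cr_e C (Suc j) (\<psi> b)"
        using diagram_rotation_raising[OF C bij _ _ _, of "Suc j" j b] comm[of j] j b verts by simp
      then show "word_e i (word k l (\<psi> b)) 0 = None"
        using none[OF j(2,3)] classical[of j b] classical[of "Suc j" "\<psi> b"] j b \<psi>b
        by (simp flip: cst_e_word)
    qed
    have "mult 1 (\<psi> b) = mult 1 T"
      using mult_one_rotated[OF n C conn fin CST bij comm] b mult verts by simp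
    then have eq: "the (T (r, c)) = the (\<psi> b (r, c))" if "(r, c) \<in> rect k l" for r c
      using highest_weight_entry[OF T l highest(1), of r c]
        highest_weight_entry[OF \<psi>b l highest(2), of r c] that
      by (simp add: rect_def)
    show ?thesis
    proof
      fix p :: cell
      show "T p = \<psi> b p"
      proof (cases "p \<in> rect k l")
        case True
        then show ?thesis
          using eq[of "fst p" "snd p"] CST_entry[OF T True] CST_entry[OF \<psi>b True] by simp
      next
        case False
        then have "p \<notin> dom T" "p \<notin> dom (\<psi> b)"
          using T \<psi>b by (simp_all add: CST_def)
        then show ?thesis by (simp add: domIff)
      qed
    qed
  qed
qed

theorem proposition8:
  fixes n k l :: nat
    and V :: "'v::ab_group_add qmodule"
    and B :: "filling crystal_data"
    and \<psi> :: "filling \<Rightarrow> filling"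
  assumes "n \<ge> 2" and "1 \<le> k" and "k \<le> n - 1" and "l \<ge> 1"
    and "KR_crystal n k l V B"
    and "bij_betw \<psi> (verts B) (verts B)"
    and "\<And>i b. i < n \<Longrightarrow> b \<in> verts B \<Longrightarrow>
           map_option \<psi> (cr_f B i b) = cr_f B (Suc i mod n) (\<psi> b)"
  shows "\<forall>b\<in>verts B. \<psi> b = pr n k l b"
proof
  fix b assume b: "b \<in> verts B"
  have B: "affine_crystal n B" "crystal_connected n B" "crystal_graph_of n V B"
    "restricts_to_CST n k l B"
    using assms(5) by (simp_all add: KR_crystal_def)
  have fin: "finite (verts B)"
    using B(3) by (auto simp: crystal_graph_of_def crystal_pseudobase_def)
  have CST: "b \<in> CST n k l"
    using b B(4) by (simp add: restricts_to_CST_def)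
  have "pr n k l b = \<psi> b"
    using promotion_CST[OF CST assms(2)] assms(1)
    by (intro raising_determines_rotation[OF assms(1,2,4) B(1,2) fin B(4) assms(6,7) CST]) auto
  then show "\<psi> b = pr n k l b" ..
qed

end
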